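(* Let $d\ge 2$, $e\ge 1$ be integers, $T>0$, $r>0$. Let $X\in C^{1\text{-var}}([0,T],\mathbb R^d)$, $A\in\mathcal L(\mathbb R^d,\mathcal L(\mathbb R^e,\mathbb R^e))$ with $|A|\le r$, $y_0\in\mathbb R^e$, let $N,m\ge1$ be integers and let $\pi=\{0=t_0<t_1<\dots<t_m=T\}$ be a partition of $[0,T]$ with $m$ intervals. Then $$\big|\Phi^A_{0,T}(X)y_0-\mathcal E^A_N(X)_\pi\, y_0\big|\le \frac{r^{N+1}}{(N+1)!}\exp\big(r\|X\|_{1\text{-var}}\big)\,|y_0|\sum_{k=1}^m\|X\|_{1\text{-var},[t_{k-1},t_k]}^{N+1}.$$ If $\pi$ is an equal length split, i.e. $\|X\|_{1\text{-var},[t_{k-1},t_k]}=\|X\|_{1\text{-var}}/m$ for all $k=1,\dots,m$, then the right-hand side equals $$\frac{(r\|X\|_{1\text{-var}})^{N+1}}{(N+1)!\,m^N}\exp\big(r\|X\|_{1\text{-var}}\big)\,|y_0| ,$$ and the equal length split minimises the right-hand side of the first inequality among all partitions of $[0,T]$ with $m$ intervals. Moreover this last bound is asymptotically sharp in the following sense. For every $r>0$ and $L>0$ there exist $d,e$, a path $X$ with $\|X\|_{1\text{-var}}=L$, a map $A$ with $|A|= r$ and a vector $y_0\ne0$ such that, denoting by $\mathrm{err}(N,m)$ the error $|\Phi^A_{0,T}(X)y_0-\mathcal E^A_N(X)_\pi y_0|$ for $\pi$ the equal length split with $m$ intervals, and by $\mathrm{bd}(N,m):=\frac{(rL)^{N+1}}{(N+1)!\,m^N}e^{rL}|y_0|$: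 (i) for each fixed $N$, $\mathrm{err}(N,m)/\mathrm{bd}(N,m)\to1$ as $m\to\infty$; (ii) for each fixed $m$, $\mathrm{err}(N,m)/\mathrm{bd}(N,m)\to c_m$ as $N\to\infty$, where $c_m>0$ does not depend on $N$ and $c_m\to1$ as $m\to\infty$.
   Context: $C^{1\text{-var}}([0,T],\mathbb R^d)$ is the set of continuous paths of bounded variation; $\|X\|_{1\text{-var},[s,t]}$ is the length (total variation with respect to the Euclidean norm) of $X$ on $[s,t]$, and $\|X\|_{1\text{-var}}:=\|X\|_{1\text{-var},[0,T]}$. The signature of $X$ is $\mathcal S^n(X)_{s,t}=\int_{s<u_1<\dots<u_n<t}\mathrm dX_{u_1}\otimes\cdots\otimes \mathrm dX_{u_n}\in(\mathbb R^d)^{\otimes n}$, with $\mathcal S^0=1$. For $A\in\mathcal L(\mathbb R^d,\mathcal L(\mathbb R^e,\mathbb R^e))$, $|A|$ is the Euclidean (Frobenius) norm of $A$ seen as an array of $d e^2$ real coefficients. For $S\in(\mathbb R^d)^{\otimes n}$, $y\in\mathbb R^e$, $A^{\otimes n}yS$ is the linear extension in $S$ of $A^{\otimes n}y\,(x_1\otimes\cdots\otimes x_n)=A(x_n)\cdots A(x_1)y$. $\Phi^A_{s,t}(X)\in\mathcal L(\mathbb R^e,\mathbb R^e)$ is the solution map $Y_s\mapsto Y_t$ of the linear controlled differential equation $\mathrm dY=A(\mathrm dX)Y$; it is given by $\Phi^A_{s,t}(X)y=\sum_{n\ge0}A^{\otimes n}y\,\mathcal S^n(X)_{s,t}$. The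 one-step degree-$N$ Euler scheme is $\mathcal E^A_{N;s,t}(X)y=\sum_{n=0}^N A^{\otimes n}y\,\mathcal S^n(X)_{s,t}$ and, for $\pi=\{0=t_0<\dots<t_m=T\}$, $\mathcal E^A_N(X)_\pi=\mathcal E^A_{N;t_{m-1},t_m}(X)\cdots\mathcal E^A_{N;t_0,t_1}(X)$. Norms on $\mathbb R^e$ are Euclidean. *)

theory Defs
  imports "HOL-Analysis.Analysis"
begin

(* Dimensions occur under quantifiers, so they are natural numbers rather than types: a vector
   of R^d is a function of type nat => real of which only the coordinates i < d are meaningful.
   The Euclidean norm of such an x is L2_set x {..<d}. *)

type_synonym rvec = "nat \<Rightarrow> real"

abbreviation vnorm :: "nat \<Rightarrow> rvec \<Rightarrow> real" where
  "vnorm d x \<equiv> L2_set x {..<d}"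


section \<open>Paths of bounded variation\<close>

(* In a division of an interval every piece K is a nonempty compact interval {Inf K..Sup K}. *)

definition variation_sums :: "nat \<Rightarrow> (real \<Rightarrow> rvec) \<Rightarrow> real \<Rightarrow> real \<Rightarrow> real set" where
  "variation_sums d X a b =
     {(\<Sum>K\<in>D. vnorm d (\<lambda>i. X (Sup K) i - X (Inf K) i)) |D. D division_of {a..b}}"

(* The supremum is that of a set of reals, hence meaningful only for paths of bounded variation. *)
definition var1 :: "nat \<Rightarrow> (real \<Rightarrow> rvec) \<Rightarrow> real \<Rightarrow> real \<Rightarrow> real" where
  "var1 d X a b = Sup (variation_sums d X a b)"

definition C1var :: "nat \<Rightarrow> real \<Rightarrow> (real \<Rightarrow> rvec) set" where
  "C1var d T =
     {X. (\<forall>i<d. continuous_on {0..T} (\<lambda>t. X t i)) \<and> bdd_above (variation_sums d X 0 T)}"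


section \<open>Riemann--Stieltjes integrals and signatures\<close>

definition has_rs_integral ::
    "(real \<Rightarrow> real) \<Rightarrow> (real \<Rightarrow> real) \<Rightarrow> real \<Rightarrow> real \<Rightarrow> real \<Rightarrow> bool" where
  "has_rs_integral f g a b I \<longleftrightarrow>
     (\<forall>\<epsilon>>0. \<exists>\<delta>>0. \<forall>p. p tagged_division_of {a..b} \<and> (\<lambda>x. ball x \<delta>) fine p \<longrightarrow>
        \<bar>(\<Sum>(x, K)\<in>p. f x * (g (Sup K) - g (Inf K))) - I\<bar> < \<epsilon>)"

definition rs_integral ::
    "(real \<Rightarrow> real) \<Rightarrow> (real \<Rightarrow> real) \<Rightarrow> real \<Rightarrow> real \<Rightarrow> real" where
  "rs_integral f g a b = (THE I. has_rs_integral f g a b I)"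

(* A tensor of level n is a function on the words of length n over {..<d}: its value at
   w = [i1, ..., in] is the coefficient of the basis tensor e_i1 (x) ... (x) e_in. *)

definition words :: "nat \<Rightarrow> nat \<Rightarrow> nat list set" where
  "words d n = {w. length w = n \<and> set w \<subseteq> {..<d}}"

(* Iterated integral with the word read backwards: the head of the list belongs to the
   outermost integration variable, i.e. to the latest time u_n. *)
primrec sig_rev :: "(real \<Rightarrow> rvec) \<Rightarrow> real \<Rightarrow> nat list \<Rightarrow> real \<Rightarrow> real" where
  "sig_rev X s [] t = 1"
| "sig_rev X s (i # w) t = rs_integral (\<lambda>u. sig_rev X s w u) (\<lambda>u. X u i) s t"

definition signature :: "(real \<Rightarrow> rvec) \<Rightarrow> real \<Rightarrow> real \<Rightarrow> nat list \<Rightarrow> real" where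
  "signature X s t w = sig_rev X s (rev w) t"


section \<open>Linear controlled differential equations and the Euler scheme\<close>

(* An element A of L(R^d, L(R^e, R^e)) is given by its d * e^2 coefficients: A i j k is the
   (j, k) entry of the matrix of A(e_i). *)

type_synonym lin_field = "nat \<Rightarrow> nat \<Rightarrow> nat \<Rightarrow> real"

definition frob :: "nat \<Rightarrow> nat \<Rightarrow> lin_field \<Rightarrow> real" where
  "frob d e A = L2_set (\<lambda>(i, j, k). A i j k) ({..<d} \<times> {..<e} \<times> {..<e})"

definition lin_app :: "nat \<Rightarrow> nat \<Rightarrow> lin_field \<Rightarrow> rvec \<Rightarrow> rvec \<Rightarrow> rvec" where
  "lin_app d e A x v = (\<lambda>j. \<Sum>i<d. x i * (\<Sum>k<e. A i j k * v k))"

definition basis_vec :: "nat \<Rightarrow> rvec" where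
  "basis_vec i = (\<lambda>l. if l = i then 1 else 0)"

definition tensor_app ::
    "nat \<Rightarrow> nat \<Rightarrow> lin_field \<Rightarrow> nat \<Rightarrow> rvec \<Rightarrow> (nat list \<Rightarrow> real) \<Rightarrow> rvec" where
  "tensor_app d e A n y S =
     (\<lambda>j. \<Sum>w\<in>words d n. S w * fold (\<lambda>i. lin_app d e A (basis_vec i)) w y j)"

lemma lin_app_basis_sum:
  "lin_app d e A x v j = (\<Sum>i<d. x i * lin_app d e A (basis_vec i) v j)"
proof -
  have "lin_app d e A (basis_vec i) v j = (\<Sum>k<e. A i j k * v k)" if "i < d" for i
  proof -
    have "lin_app d e A (basis_vec i) v j = (\<Sum>l<d. if l = i then \<Sum>k<e. A l j k * v k else 0)"
      unfolding lin_app_def basis_vec_def by (intro sum.cong) auto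
    then show ?thesis using that by simp
  qed
  then show ?thesis by (simp add: lin_app_def)
qed

lemma lin_app_sum:
  assumes "finite W"
  shows "lin_app d e A x (\<lambda>k. \<Sum>w\<in>W. c w * f w k) j = (\<Sum>w\<in>W. c w * lin_app d e A x (f w) j)"
proof -
  have "lin_app d e A x (\<lambda>k. \<Sum>w\<in>W. c w * f w k) j =
      (\<Sum>i<d. \<Sum>k<e. \<Sum>w\<in>W. x i * (A i j k * (c w * f w k)))"
    by (simp add: lin_app_def sum_distrib_left)
  also have "\<dots> = (\<Sum>i<d. \<Sum>w\<in>W. \<Sum>k<e. x i * (A i j k * (c w * f w k)))"
    by (intro sum.cong refl sum.swap)
  also have "\<dots> = (\<Sum>w\<in>W. \<Sum>i<d. \<Sum>k<e. x i * (A i j k * (c w * f w k)))"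
    by (rule sum.swap)
  also have "\<dots> = (\<Sum>w\<in>W. c w * lin_app d e A x (f w) j)"
    by (simp add: lin_app_def sum_distrib_left mult_ac)
  finally show ?thesis .
qed

lemma finite_words: "finite (words d n)"
  using finite_lists_length_eq[of "{..<d}" n] by (simp add: words_def conj_commute)

lemma sum_words_Suc:
  "(\<Sum>w\<in>words d (Suc n). F w) = (\<Sum>w\<in>words d n. \<Sum>i<d. F (w @ [i]))"
proof -
  have "bij_betw (\<lambda>(w, i). w @ [i]) (words d n \<times> {..<d}) (words d (Suc n))"
    unfolding bij_betw_def
  proof
    show "inj_on (\<lambda>(w, i). w @ [i]) (words d n \<times> {..<d})" by (auto simp: inj_on_def)
    show "(\<lambda>(w, i). w @ [i]) ` (words d n \<times> {..<d}) = words d (Suc n)"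
    proof
      show "words d (Suc n) \<subseteq> (\<lambda>(w, i). w @ [i]) ` (words d n \<times> {..<d})"
      proof
        fix w assume w: "w \<in> words d (Suc n)"
        then obtain v i where "w = v @ [i]"
          by (cases w rule: rev_cases) (auto simp: words_def)
        then show "w \<in> (\<lambda>(w, i). w @ [i]) ` (words d n \<times> {..<d})"
          using w by (force simp: words_def)
      qed
    qed (auto simp: words_def)
  qed
  then have "(\<Sum>w\<in>words d (Suc n). F w) = (\<Sum>(w, i)\<in>words d n \<times> {..<d}. F (w @ [i]))"
    by (subst sum.reindex_bij_betw[symmetric]) (auto simp: case_prod_unfold)
  then show ?thesis by (simp add: sum.cartesian_product)
qed

(* tensor_app is the linear extension of x_1 (x) ... (x) x_n |-> A(x_n) ... A(x_1) y. *)
lemma tensor_app_elementary: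
  "tensor_app d e A (length xs) y (\<lambda>w. \<Prod>l<length xs. (xs ! l) (w ! l)) =
     fold (lin_app d e A) xs y"
proof (induction xs rule: rev_induct)
  case Nil
  have "words d 0 = {[]}" by (auto simp: words_def)
  then show ?case by (simp add: tensor_app_def)
next
  case (snoc x xs)
  let ?n = "length xs"
  let ?P = "\<lambda>w. \<Prod>l<?n. (xs ! l) (w ! l)"
  let ?f = "\<lambda>w. fold (\<lambda>i. lin_app d e A (basis_vec i)) w y"
  have P: "(\<Prod>l<Suc ?n. ((xs @ [x]) ! l) ((w @ [i]) ! l)) = ?P w * x i"
    if "w \<in> words d ?n" for w i
    using that by (simp add: words_def nth_append)
  have "tensor_app d e A (Suc ?n) y (\<lambda>w. \<Prod>l<Suc ?n. ((xs @ [x]) ! l) (w ! l)) j =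
      lin_app d e A x (fold (lin_app d e A) xs y) j" for j
  proof -
    have "tensor_app d e A (Suc ?n) y (\<lambda>w. \<Prod>l<Suc ?n. ((xs @ [x]) ! l) (w ! l)) j =
        (\<Sum>w\<in>words d ?n. \<Sum>i<d. (?P w * x i) * lin_app d e A (basis_vec i) (?f w) j)"
      unfolding tensor_app_def sum_words_Suc
      by (intro sum.cong refl) (simp only: P fold_append fold.simps comp_def id_apply)
    also have "\<dots> = (\<Sum>w\<in>words d ?n. ?P w * lin_app d e A x (?f w) j)"
      by (subst (2) lin_app_basis_sum) (simp add: sum_distrib_left mult.assoc)
    also have "\<dots> = lin_app d e A x (tensor_app d e A ?n y ?P) j"
      unfolding tensor_app_def by (subst lin_app_sum) (auto simp: finite_words)
    finally show ?thesis by (simp only: snoc.IH)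
  qed
  then show ?case by (simp add: fun_eq_iff)
qed

(* dY = A(dX) Y on [s, t], in integrated form and in coordinates. *)
definition cde_solution ::
    "nat \<Rightarrow> nat \<Rightarrow> lin_field \<Rightarrow> (real \<Rightarrow> rvec) \<Rightarrow> real \<Rightarrow> real \<Rightarrow> (real \<Rightarrow> rvec) \<Rightarrow> bool" where
  "cde_solution d e A X s t Y \<longleftrightarrow>
     (\<forall>j<e. continuous_on {s..t} (\<lambda>u. Y u j)) \<and>
     (\<forall>u\<in>{s..t}. \<forall>j<e. Y u j = Y s j +
        (\<Sum>i<d. \<Sum>k<e. A i j k * rs_integral (\<lambda>v. Y v k) (\<lambda>v. X v i) s u))"

(* The solution is unique on [s, t] in the meaningful coordinates; the remaining ones are
   set to 0 so that the definite description is well defined. *)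
definition flow ::
    "nat \<Rightarrow> nat \<Rightarrow> lin_field \<Rightarrow> (real \<Rightarrow> rvec) \<Rightarrow> real \<Rightarrow> real \<Rightarrow> rvec \<Rightarrow> rvec" where
  "flow d e A X s t y =
     (THE z. (\<forall>j\<ge>e. z j = 0) \<and>
        (\<exists>Y. cde_solution d e A X s t Y \<and> (\<forall>j<e. Y s j = y j) \<and> (\<forall>j<e. Y t j = z j)))"

definition euler_step ::
    "nat \<Rightarrow> nat \<Rightarrow> lin_field \<Rightarrow> nat \<Rightarrow> (real \<Rightarrow> rvec) \<Rightarrow> real \<Rightarrow> real \<Rightarrow> rvec \<Rightarrow> rvec" where
  "euler_step d e A N X s t y = (\<lambda>j. \<Sum>n\<le>N. tensor_app d e A n y (signature X s t) j)"

primrec euler_scheme ::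
    "nat \<Rightarrow> nat \<Rightarrow> lin_field \<Rightarrow> nat \<Rightarrow> (real \<Rightarrow> rvec) \<Rightarrow> (nat \<Rightarrow> real) \<Rightarrow> nat \<Rightarrow> rvec \<Rightarrow> rvec" where
  "euler_scheme d e A N X \<pi> 0 y = y"
| "euler_scheme d e A N X \<pi> (Suc m) y =
     euler_step d e A N X (\<pi> m) (\<pi> (Suc m)) (euler_scheme d e A N X \<pi> m y)"


section \<open>Partitions\<close>

(* Only the values \<pi> 0, ..., \<pi> m matter. *)
definition is_partition :: "real \<Rightarrow> nat \<Rightarrow> (nat \<Rightarrow> real) \<Rightarrow> bool" where
  "is_partition T m \<pi> \<longleftrightarrow> \<pi> 0 = 0 \<and> \<pi> m = T \<and> (\<forall>k<m. \<pi> k < \<pi> (Suc k))"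

definition equal_length_split ::
    "nat \<Rightarrow> (real \<Rightarrow> rvec) \<Rightarrow> real \<Rightarrow> nat \<Rightarrow> (nat \<Rightarrow> real) \<Rightarrow> bool" where
  "equal_length_split d X T m \<pi> \<longleftrightarrow> is_partition T m \<pi> \<and>
     (\<forall>k<m. var1 d X (\<pi> k) (\<pi> (Suc k)) = var1 d X 0 T / real m)"

definition euler_error ::
    "nat \<Rightarrow> nat \<Rightarrow> lin_field \<Rightarrow> (real \<Rightarrow> rvec) \<Rightarrow> real \<Rightarrow> rvec \<Rightarrow> nat \<Rightarrow> nat \<Rightarrow> (nat \<Rightarrow> real) \<Rightarrow> real"
  where
  "euler_error d e A X T y N m \<pi> =
     vnorm e (\<lambda>j. flow d e A X 0 T y j - euler_scheme d e A N X \<pi> m y j)"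

(* The right-hand side of the error estimate for a general partition. *)
definition partition_bound ::
    "real \<Rightarrow> nat \<Rightarrow> nat \<Rightarrow> (real \<Rightarrow> rvec) \<Rightarrow> real \<Rightarrow> rvec \<Rightarrow> nat \<Rightarrow> nat \<Rightarrow> (nat \<Rightarrow> real) \<Rightarrow> real"
  where
  "partition_bound r d e X T y N m \<pi> =
     r ^ (N + 1) / fact (N + 1) * exp (r * var1 d X 0 T) * vnorm e y *
       (\<Sum>k<m. var1 d X (\<pi> k) (\<pi> (Suc k)) ^ (N + 1))"

(* The same for an equal length split; L is the length of the path. *)
definition split_bound :: "real \<Rightarrow> real \<Rightarrow> nat \<Rightarrow> rvec \<Rightarrow> nat \<Rightarrow> nat \<Rightarrow> real" where
  "split_bound r L e y N m =
     (r * L) ^ (N + 1) / (fact (N + 1) * real m ^ N) * exp (r * L) * vnorm e y"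

end

theory Submission
  imports Defs
begin

text \<open>Let \<open>V u\<close> be the length of \<open>X\<close> on \<open>[0, u]\<close>. It is continuous and \<open>V q - V p\<close> is the length
  on \<open>[p, q]\<close>, because the length is the least additive interval function that dominates the norms of
  the increments of \<open>X\<close> (\<open>var1_le_diff\<close>). Stieltjes integrals are handled through primitives: the
  relation \<open>drives s t Y Z\<close>, which stands for \<open>dZ = A(dX) Y\<close> on \<open>[s, t]\<close>, says that the increments of
  \<open>Z\<close> are the Riemann summands up to \<open>o(V q - V p)\<close>. It is linear, it localises, and it implies that
  the norm of \<open>Z t - Z s\<close> is at most \<open>G t - G s\<close> as soon as \<open>r * (V q - V p) * \<bar>Y p\<bar> \<le> G q - G p\<close> for all
  \<open>p \<le> q\<close> in \<open>[s, t]\<close> (\<open>drives_growth\<close>).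

  By induction on \<open>n\<close>, the \<open>n\<close>-th term of the signature series is at most
  \<open>(r * (V u - V s))^n / n! * \<bar>y\<bar>\<close> (\<open>level_bound\<close>). The same induction shows that solutions of the
  equation are unique, and the series is a solution, hence it is the flow (\<open>flow_eq_series\<close>). Both the
  flow and the Euler step over \<open>[s, t]\<close> have operator norm at most \<open>exp (r * (V t - V s))\<close>, and their
  difference is a tail of the exponential series. Telescoping over the partition gives the error bound
  (\<open>euler_scheme_error\<close>). An equal length split exists by the intermediate value theorem for \<open>V\<close>, and
  it is optimal by the power mean inequality.

  For sharpness, take a straight path and the scalar equation \<open>dY = r Y dX\<^sub>0\<close>. With \<open>h = r L / m\<close>
  and the Taylor polynomial \<open>P\<close> of degree \<open>N\<close> of the exponential function, the error is
  \<open>exp (r L) - P(h)^m\<close>. By convexity of \<open>x \<mapsto> x^m\<close> and the size of \<open>exp h - P(h)\<close>, its ratio to the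
  bound lies between \<open>P(h)^(m - 1) * exp (- r L)\<close> and \<open>(1 + h * exp h / (N + 2)) * exp (- h)\<close>
  (\<open>exp_poly_power_ratio_bounds\<close>). Both tend to \<open>1\<close> as \<open>m\<close> grows and to \<open>exp (- h)\<close> as \<open>N\<close> grows.\<close>

section \<open>Total variation of a path\<close>

lemma division_pieceE:
  assumes "D division_of {a..b::real}" "K \<in> D"
  obtains p q where "K = {p..q}" "a \<le> p" "p \<le> q" "q \<le> b"
proof -
  obtain p q where K: "K = {p..q}" using division_ofD(4)[OF assms] by auto
  moreover have "K \<noteq> {}" "K \<subseteq> {a..b}" using division_ofD(2,3)[OF assms] by auto
  ultimately show ?thesis using that by auto
qed

lemma division_sum_le_diff:
  fixes W :: "real \<Rightarrow> real"
  assumes D: "D division_of {a..b}" and "a \<le> b"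
    and le: "\<And>p q. \<lbrakk>a \<le> p; p \<le> q; q \<le> b\<rbrakk> \<Longrightarrow> \<phi> p q \<le> W q - W p"
  shows "(\<Sum>K\<in>D. \<phi> (Inf K) (Sup K)) \<le> W b - W a"
proof -
  have "(\<Sum>K\<in>D. \<phi> (Inf K) (Sup K)) \<le> (\<Sum>K\<in>D. W (Sup K) - W (Inf K))"
  proof (rule sum_mono)
    fix K assume "K \<in> D"
    with D obtain p q where "K = {p..q}" "a \<le> p" "p \<le> q" "q \<le> b" by (rule division_pieceE)
    then show "\<phi> (Inf K) (Sup K) \<le> W (Sup K) - W (Inf K)" using le by simp
  qed
  also have "\<dots> = (\<Sum>(x, K)\<in>(\<lambda>K. (Inf K, K)) ` D. W (Sup K) - W (Inf K))"
    by (subst sum.reindex) (auto simp: inj_on_def)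
  also have "\<dots> = W b - W a"
  proof (rule additive_tagged_division_1[OF \<open>a \<le> b\<close>], rule tagged_division_ofI)
    show "finite ((\<lambda>K. (Inf K, K)) ` D)" using D by auto
    show "\<Union> {K. \<exists>x. (x, K) \<in> (\<lambda>K. (Inf K, K)) ` D} = {a..b}"
    proof -
      have "{K. \<exists>x. (x, K) \<in> (\<lambda>K. (Inf K, K)) ` D} = D" by auto
      then show ?thesis using division_ofD(6)[OF D] by simp
    qed
    fix x K assume "(x, K) \<in> (\<lambda>K. (Inf K, K)) ` D"
    then have x: "x = Inf K" "K \<in> D" by auto
    from D x(2) obtain p q where "K = {p..q}" "a \<le> p" "p \<le> q" "q \<le> b"
      by (rule division_pieceE)
    then show "x \<in> K" "K \<subseteq> {a..b}" "\<exists>a b. K = cbox a b"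
      using x by (auto intro: exI[of _ p] exI[of _ q])
  next
    fix x1 K1 x2 K2
    assume "(x1, K1) \<in> (\<lambda>K. (Inf K, K)) ` D" "(x2, K2) \<in> (\<lambda>K. (Inf K, K)) ` D"
      "(x1, K1) \<noteq> (x2, K2)"
    then show "interior K1 \<inter> interior K2 = {}"
      using division_ofD(5)[OF D, of K1 K2] by auto
  qed
  finally show ?thesis .
qed

lemma variation_sums_add:
  assumes "a \<le> b" "b \<le> c" "x \<in> variation_sums d X a b" "y \<in> variation_sums d X b c"
  shows "x + y \<in> variation_sums d X a c"
proof -
  let ?\<phi> = "\<lambda>K. vnorm d (\<lambda>i. X (Sup K) i - X (Inf K) i)"
  obtain D E where D: "D division_of {a..b}" "x = sum ?\<phi> D"
    and E: "E division_of {b..c}" "y = sum ?\<phi> E"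
    using assms(3,4) by (auto simp: variation_sums_def)
  have "D \<union> E division_of {a..b} \<union> {b..c}"
    by (intro division_disjoint_union D E) auto
  moreover have "{a..b} \<union> {b..c} = {a..c}" using assms by auto
  moreover have "sum ?\<phi> (D \<union> E) = sum ?\<phi> D + sum ?\<phi> E"
  proof (rule sum.union_inter_neutral)
    show "finite D" "finite E" using D E by auto
    \<comment> \<open>a piece common to both divisions is the degenerate interval at \<open>b\<close>\<close>
    show "\<forall>K\<in>D \<inter> E. ?\<phi> K = 0"
    proof
      fix K assume K: "K \<in> D \<inter> E"
      then have "K \<subseteq> {b}" using division_ofD(2)[OF D(1)] division_ofD(2)[OF E(1)] by force
      moreover have "K \<noteq> {}" using K D by auto
      ultimately have "K = {b}" by blast
      then show "?\<phi> K = 0" by (simp add: L2_set_def)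
    qed
  qed
  ultimately have "D \<union> E division_of {a..c}" "x + y = sum ?\<phi> (D \<union> E)" using D E by simp_all
  then show ?thesis unfolding variation_sums_def by blast
qed

lemma variation_sums_trivial:
  "a \<le> b \<Longrightarrow> vnorm d (\<lambda>i. X b i - X a i) \<in> variation_sums d X a b"
  unfolding variation_sums_def
  using division_of_self[of a b] by (intro CollectI exI[of _ "{{a..b}}"]) simp

lemma vnorm_triangle: "vnorm d (\<lambda>i. x i + y i) \<le> vnorm d x + vnorm d y"
  by (rule L2_set_triangle_ineq)

lemma vnorm_diff_triangle:
  "vnorm d (\<lambda>i. x i - z i) \<le> vnorm d (\<lambda>i. x i - y i) + vnorm d (\<lambda>i. y i - z i)"
  using vnorm_triangle[of "\<lambda>i. x i - y i" "\<lambda>i. y i - z i" d] by simp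

lemma vnorm_minus_commute: "vnorm d (\<lambda>i. x i - y i) = vnorm d (\<lambda>i. y i - x i)"
  by (simp add: L2_set_def power2_commute)

lemma abs_le_vnorm: "i < d \<Longrightarrow> \<bar>x i\<bar> \<le> vnorm d x"
  using member_le_L2_set[of "{..<d}" i "\<lambda>i. \<bar>x i\<bar>"] by (simp add: L2_set_def)

lemma tendsto_vnorm:
  assumes "\<And>j. j < e \<Longrightarrow> ((\<lambda>n. f n j) \<longlongrightarrow> g j) F"
  shows "((\<lambda>n. vnorm e (f n)) \<longlongrightarrow> vnorm e g) F"
  unfolding L2_set_def using assms by (intro tendsto_intros) auto

text \<open>A continuous path of bounded variation on \<open>[0, T]\<close>.\<close>

locale bv_path =
  fixes d :: nat and X :: "real \<Rightarrow> rvec" and T :: real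
  assumes T: "0 < T" and X: "X \<in> C1var d T"
begin

lemma bdd_variation_sums:
  assumes "0 \<le> a" "a \<le> b" "b \<le> T"
  shows "bdd_above (variation_sums d X a b)"
proof -
  obtain M where M: "\<And>x. x \<in> variation_sums d X 0 T \<Longrightarrow> x \<le> M"
    using X by (auto simp: C1var_def bdd_above_def)
  show ?thesis
  proof (rule bdd_aboveI)
    fix x assume x: "x \<in> variation_sums d X a b"
    let ?u = "vnorm d (\<lambda>i. X a i - X 0 i)" and ?v = "vnorm d (\<lambda>i. X T i - X b i)"
    have "?u + x + ?v \<in> variation_sums d X 0 T"
      using assms x by (intro variation_sums_add[of 0 b T] variation_sums_add[of 0 a b]
          variation_sums_trivial) auto
    then have "?u + x + ?v \<le> M" by (rule M)
    moreover have "0 \<le> ?u" "0 \<le> ?v" by simp_all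
    ultimately show "x \<le> M" by linarith
  qed
qed

lemma vnorm_le_var1:
  assumes "0 \<le> a" "a \<le> b" "b \<le> T"
  shows "vnorm d (\<lambda>i. X b i - X a i) \<le> var1 d X a b"
  unfolding var1_def
  by (rule cSup_upper[OF variation_sums_trivial bdd_variation_sums]) (use assms in auto)

text \<open>The variation is the least additive interval function dominating the norms of the
  increments; its additivity and its continuity are both read off from this minimality.\<close>

lemma var1_le_diff:
  fixes W :: "real \<Rightarrow> real"
  assumes "a \<le> b"
    and "\<And>p q. \<lbrakk>a \<le> p; p \<le> q; q \<le> b\<rbrakk> \<Longrightarrow> vnorm d (\<lambda>i. X q i - X p i) \<le> W q - W p"
  shows "var1 d X a b \<le> W b - W a"
  unfolding var1_def
proof (rule cSup_least)
  show "variation_sums d X a b \<noteq> {}" using variation_sums_trivial[OF assms(1)] by blast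
  fix x assume "x \<in> variation_sums d X a b"
  then obtain D where D: "D division_of {a..b}"
    and x: "x = (\<Sum>K\<in>D. vnorm d (\<lambda>i. X (Sup K) i - X (Inf K) i))"
    by (auto simp: variation_sums_def)
  show "x \<le> W b - W a"
    unfolding x
    by (rule division_sum_le_diff[OF D assms(1), of "\<lambda>p q. vnorm d (\<lambda>i. X q i - X p i)"])
       (rule assms(2))
qed

lemma var1_superadd:
  assumes "0 \<le> a" "a \<le> b" "b \<le> c" "c \<le> T"
  shows "var1 d X a b + var1 d X b c \<le> var1 d X a c"
proof -
  let ?S = "variation_sums d X"
  have bdd: "bdd_above (?S a c)" by (rule bdd_variation_sums) (use assms in auto)
  have ne: "?S a b \<noteq> {}" "?S b c \<noteq> {}" using variation_sums_trivial assms by blast+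
  have add: "x + y \<le> var1 d X a c" if "x \<in> ?S a b" "y \<in> ?S b c" for x y
    unfolding var1_def using variation_sums_add[OF assms(2,3) that] bdd by (rule cSup_upper)
  have "x \<le> var1 d X a c - var1 d X b c" if "x \<in> ?S a b" for x
  proof -
    have "var1 d X b c \<le> var1 d X a c - x"
      unfolding var1_def[of _ _ b]
    proof (intro cSup_least ne)
      fix y assume "y \<in> ?S b c"
      from add[OF that this] show "y \<le> var1 d X a c - x" by simp
    qed
    then show ?thesis by simp
  qed
  then have "var1 d X a b \<le> var1 d X a c - var1 d X b c"
    unfolding var1_def[of _ _ a b] by (intro cSup_least ne) auto
  then show ?thesis by simp
qed

lemma var1_nonneg: "\<lbrakk>0 \<le> a; a \<le> b; b \<le> T\<rbrakk> \<Longrightarrow> 0 \<le> var1 d X a b"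
  using vnorm_le_var1[of a b] L2_set_nonneg order_trans by blast

lemma var1_self: "0 \<le> a \<Longrightarrow> a \<le> T \<Longrightarrow> var1 d X a a = 0"
  using var1_superadd[of a a a] var1_nonneg[of a a] by simp

text \<open>The arc length function.\<close>

definition V :: "real \<Rightarrow> real" where "V u = var1 d X 0 u"

lemma V_0: "V 0 = 0" using var1_self T by (simp add: V_def)

lemma vnorm_le_V_diff:
  assumes "0 \<le> a" "a \<le> b" "b \<le> T"
  shows "vnorm d (\<lambda>i. X b i - X a i) \<le> V b - V a"
  using vnorm_le_var1[OF assms] var1_superadd[of 0 a b] assms by (simp add: V_def)

lemma var1_eq_V_diff:
  assumes "0 \<le> a" "a \<le> b" "b \<le> T"
  shows "var1 d X a b = V b - V a"
proof (rule antisym)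
  show "var1 d X a b \<le> V b - V a"
    by (rule var1_le_diff) (use assms vnorm_le_V_diff in auto)
  \<comment> \<open>subadditivity: the length up to \<open>a\<close> continued by the length from \<open>a\<close> dominates the increments\<close>
  let ?W = "\<lambda>u. if u \<le> a then V u else V a + var1 d X a u"
  have "var1 d X 0 b \<le> ?W b - ?W 0"
  proof (rule var1_le_diff)
    fix p q assume pq: "0 \<le> p" "p \<le> q" "q \<le> b"
    consider "q \<le> a" | "a < p" | "p \<le> a" "a < q" by linarith
    then show "vnorm d (\<lambda>i. X q i - X p i) \<le> ?W q - ?W p"
    proof cases
      case 1
      then show ?thesis using vnorm_le_V_diff[of p q] pq assms by simp
    next
      case 2
      then show ?thesis
        using vnorm_le_var1[of p q] var1_superadd[of a p q] pq assms by simp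
    next
      case 3
      then show ?thesis
        using vnorm_le_V_diff[of p a] vnorm_le_var1[of a q] pq assms
          vnorm_diff_triangle[of "X q" "X p" d "X a"] by simp
    qed
  qed (use assms in auto)
  then show "V b - V a \<le> var1 d X a b"
    using assms var1_self[of a] V_0 by (auto simp: V_def split: if_splits)
qed

lemma V_mono: "\<lbrakk>0 \<le> a; a \<le> b; b \<le> T\<rbrakk> \<Longrightarrow> V a \<le> V b"
  using var1_nonneg[of a b] var1_eq_V_diff[of a b] by simp

lemma V_nonneg: "\<lbrakk>0 \<le> a; a \<le> T\<rbrakk> \<Longrightarrow> 0 \<le> V a"
  using V_mono[of 0 a] V_0 by simp

lemma X_continuous: "i < d \<Longrightarrow> continuous_on {0..T} (\<lambda>t. X t i)"
  using X by (simp add: C1var_def)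

lemma tendsto_X_diff:
  assumes "t \<in> {0..T}" "\<forall>\<^sub>F u in F. u \<in> {0..T}" "filterlim (\<lambda>u. u) (nhds t) F"
  shows "((\<lambda>u. vnorm d (\<lambda>i. X u i - X p i)) \<longlongrightarrow> vnorm d (\<lambda>i. X t i - X p i)) F"
proof (rule tendsto_vnorm)
  fix j assume "j < d"
  have "((\<lambda>u. X u j) \<longlongrightarrow> X t j) F"
    by (rule continuous_on_tendsto_compose[OF X_continuous[OF \<open>j < d\<close>] assms(3,1,2)])
  then show "((\<lambda>n. X n j - X p j) \<longlongrightarrow> X t j - X p j) F" by (intro tendsto_intros)
qed

text \<open>If \<open>V\<close> had a jump at \<open>t\<close>, then \<open>V\<close> with the jump removed would still dominate the increments of
  the continuous path \<open>X\<close>, contradicting minimality.\<close>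

lemma V_left_approx:
  assumes "0 < t" "t \<le> T" "\<epsilon> > 0"
  obtains u where "0 \<le> u" "u < t" "V t - \<epsilon> < V u"
proof (rule ccontr)
  note found = that
  assume "\<not> thesis"
  then have le: "V u \<le> V t - \<epsilon>" if "0 \<le> u" "u < t" for u
    using that found by (meson not_le)
  let ?W = "\<lambda>u. if u < t then V u else V t - \<epsilon>"
  have "var1 d X 0 t \<le> ?W t - ?W 0"
  proof (rule var1_le_diff)
    fix p q assume pq: "0 \<le> p" "p \<le> q" "q \<le> t"
    show "vnorm d (\<lambda>i. X q i - X p i) \<le> ?W q - ?W p"
    proof (cases "q < t \<or> p = t")
      case True
      then show ?thesis using vnorm_le_V_diff[of p q] pq assms by (auto simp: L2_set_def)
    next
      case False
      then have q: "q = t" "p < t" using pq by auto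
      have "vnorm d (\<lambda>i. X t i - X p i) \<le> V t - \<epsilon> - V p"
      proof (rule tendsto_upperbound)
        show "((\<lambda>u. vnorm d (\<lambda>i. X u i - X p i)) \<longlongrightarrow> vnorm d (\<lambda>i. X t i - X p i)) (at_left t)"
        proof (rule tendsto_X_diff)
          show "\<forall>\<^sub>F u in at_left t. u \<in> {0..T}"
            using eventually_at_left_real[OF assms(1)]
            by (rule eventually_mono) (use assms in auto)
          show "filterlim (\<lambda>u. u) (nhds t) (at_left t)" by (rule tendsto_ident_at)
          show "t \<in> {0..T}" using assms by simp
        qed
        show "\<forall>\<^sub>F u in at_left t. vnorm d (\<lambda>i. X u i - X p i) \<le> V t - \<epsilon> - V p"
          using eventually_at_left_real[OF q(2)]
        proof eventually_elim
          case (elim u)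
          then show ?case using vnorm_le_V_diff[of p u] le[of u] pq assms by auto
        qed
      qed simp
      then show ?thesis using q by simp
    qed
  qed (use assms in auto)
  then show False using assms V_0 by (simp add: V_def)
qed

lemma V_right_approx:
  assumes "0 \<le> t" "t < T" "\<epsilon> > 0"
  obtains u where "t < u" "u \<le> T" "V u < V t + \<epsilon>"
proof (rule ccontr)
  note found = that
  assume "\<not> thesis"
  then have le: "V t + \<epsilon> \<le> V u" if "t < u" "u \<le> T" for u
    using that found by (meson not_le)
  let ?W = "\<lambda>u. if t < u then V u else V t + \<epsilon>"
  have "var1 d X t T \<le> ?W T - ?W t"
  proof (rule var1_le_diff)
    fix p q assume pq: "t \<le> p" "p \<le> q" "q \<le> T"
    show "vnorm d (\<lambda>i. X q i - X p i) \<le> ?W q - ?W p"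
    proof (cases "t < p \<or> q = t")
      case True
      then show ?thesis using vnorm_le_V_diff[of p q] pq assms by (auto simp: L2_set_def)
    next
      case False
      then have q: "p = t" "t < q" using pq by auto
      have "vnorm d (\<lambda>i. X t i - X q i) \<le> V q - (V t + \<epsilon>)"
      proof (rule tendsto_upperbound)
        show "((\<lambda>u. vnorm d (\<lambda>i. X u i - X q i)) \<longlongrightarrow> vnorm d (\<lambda>i. X t i - X q i)) (at_right t)"
        proof (rule tendsto_X_diff)
          show "\<forall>\<^sub>F u in at_right t. u \<in> {0..T}"
            using eventually_at_right_real[OF assms(2)]
            by (rule eventually_mono) (use assms in auto)
          show "filterlim (\<lambda>u. u) (nhds t) (at_right t)" by (rule tendsto_ident_at)
          show "t \<in> {0..T}" using assms by simp
        qed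
        show "\<forall>\<^sub>F u in at_right t. vnorm d (\<lambda>i. X u i - X q i) \<le> V q - (V t + \<epsilon>)"
          using eventually_at_right_real[OF q(2)]
        proof eventually_elim
          case (elim u)
          then show ?case
            using vnorm_le_V_diff[of u q] le[of u] pq assms vnorm_minus_commute[of "X u" "X q" d]
            by auto
        qed
      qed simp
      then show ?thesis using q vnorm_minus_commute[of "X t" "X q" d] by simp
    qed
  qed (use assms in auto)
  then show False using assms var1_eq_V_diff[of t T] by simp
qed

lemma V_continuous: "continuous_on {0..T} V"
  unfolding continuous_on_iff
proof (intro ballI allI impI)
  fix t \<epsilon> :: real assume t: "t \<in> {0..T}" and \<epsilon>: "0 < \<epsilon>"
  have "\<exists>\<delta>>0. \<forall>u\<in>{0..T}. t - \<delta> < u \<and> u \<le> t \<longrightarrow> \<bar>V u - V t\<bar> < \<epsilon>"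
  proof (cases "t = 0")
    case True
    then show ?thesis using \<epsilon> by (intro exI[of _ 1]) auto
  next
    case False
    then obtain v where v: "0 \<le> v" "v < t" "V t - \<epsilon> < V v"
      using V_left_approx[of t \<epsilon>] t \<epsilon> by auto
    have "\<bar>V u - V t\<bar> < \<epsilon>" if "u \<in> {0..T}" "t - (t - v) < u" "u \<le> t" for u
      using that t v V_mono[of v u] V_mono[of u t] by simp
    then show ?thesis using v by (intro exI[of _ "t - v"]) simp
  qed
  then obtain \<delta>1 where \<delta>1: "\<delta>1 > 0"
    "\<And>u. \<lbrakk>u \<in> {0..T}; t - \<delta>1 < u; u \<le> t\<rbrakk> \<Longrightarrow> \<bar>V u - V t\<bar> < \<epsilon>" by blast
  have "\<exists>\<delta>>0. \<forall>u\<in>{0..T}. u < t + \<delta> \<and> t \<le> u \<longrightarrow> \<bar>V u - V t\<bar> < \<epsilon>"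
  proof (cases "t = T")
    case True
    then show ?thesis using \<epsilon> by (intro exI[of _ 1]) auto
  next
    case False
    then obtain v where v: "t < v" "v \<le> T" "V v < V t + \<epsilon>"
      using V_right_approx[of t \<epsilon>] t \<epsilon> by auto
    have "\<bar>V u - V t\<bar> < \<epsilon>" if "u \<in> {0..T}" "u < t + (v - t)" "t \<le> u" for u
      using that t v V_mono[of t u] V_mono[of u v] by simp
    then show ?thesis using v by (intro exI[of _ "v - t"]) simp
  qed
  then obtain \<delta>2 where \<delta>2: "\<delta>2 > 0"
    "\<And>u. \<lbrakk>u \<in> {0..T}; u < t + \<delta>2; t \<le> u\<rbrakk> \<Longrightarrow> \<bar>V u - V t\<bar> < \<epsilon>" by blast
  show "\<exists>\<delta>>0. \<forall>u\<in>{0..T}. dist u t < \<delta> \<longrightarrow> dist (V u) (V t) < \<epsilon>"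
  proof (intro exI[of _ "min \<delta>1 \<delta>2"] conjI ballI impI)
    fix u assume "u \<in> {0..T}" "dist u t < min \<delta>1 \<delta>2"
    then show "dist (V u) (V t) < \<epsilon>"
      using \<delta>1(2)[of u] \<delta>2(2)[of u] by (cases "u \<le> t") (auto simp: dist_real_def)
  qed (use \<delta>1 \<delta>2 in auto)
qed

end


section \<open>Remainders and Riemann--Stieltjes integrals\<close>

text \<open>A function \<open>R\<close> of an interval \<open>[p, q]\<close> and a tag \<open>x\<close> in it is a remainder relative to \<open>V\<close>
  if it is \<open>o(V q - V p)\<close> as the interval shrinks, uniformly in the interval.\<close>

definition remainder :: "(real \<Rightarrow> real) \<Rightarrow> real \<Rightarrow> real \<Rightarrow> (real \<Rightarrow> real \<Rightarrow> real \<Rightarrow> real) \<Rightarrow> bool" where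
  "remainder V a b R \<longleftrightarrow> (\<forall>\<epsilon>>0. \<exists>\<delta>>0. \<forall>p x q. a \<le> p \<and> p \<le> x \<and> x \<le> q \<and> q \<le> b \<and> q - p < \<delta> \<longrightarrow>
     \<bar>R p x q\<bar> \<le> \<epsilon> * (V q - V p))"

lemma remainderE:
  assumes "remainder V a b R" "\<epsilon> > 0"
  obtains \<delta> where "\<delta> > 0"
    "\<And>p x q. \<lbrakk>a \<le> p; p \<le> x; x \<le> q; q \<le> b; q - p < \<delta>\<rbrakk> \<Longrightarrow> \<bar>R p x q\<bar> \<le> \<epsilon> * (V q - V p)"
  using assms unfolding remainder_def by meson

lemma remainder_subinterval:
  assumes "remainder V a b R" "a \<le> s" "t \<le> b"
  shows "remainder V s t R"
  unfolding remainder_def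
proof (intro allI impI)
  fix \<epsilon> :: real assume "\<epsilon> > 0"
  with assms(1) obtain \<delta> where "\<delta> > 0"
    "\<And>p x q. \<lbrakk>a \<le> p; p \<le> x; x \<le> q; q \<le> b; q - p < \<delta>\<rbrakk> \<Longrightarrow> \<bar>R p x q\<bar> \<le> \<epsilon> * (V q - V p)"
    by (rule remainderE) blast
  then show "\<exists>\<delta>>0. \<forall>p x q. s \<le> p \<and> p \<le> x \<and> x \<le> q \<and> q \<le> t \<and> q - p < \<delta> \<longrightarrow>
     \<bar>R p x q\<bar> \<le> \<epsilon> * (V q - V p)"
    using assms(2,3) by (intro exI[of _ \<delta>]) simp
qed

lemma remainder_add:
  assumes "remainder V a b R" "remainder V a b S"
  shows "remainder V a b (\<lambda>p x q. R p x q + S p x q)"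
  unfolding remainder_def
proof (intro allI impI)
  fix \<epsilon> :: real assume "\<epsilon> > 0"
  then have h: "\<epsilon> / 2 > 0" by simp
  obtain \<delta> where \<delta>: "\<delta> > 0"
    "\<And>p x q. \<lbrakk>a \<le> p; p \<le> x; x \<le> q; q \<le> b; q - p < \<delta>\<rbrakk> \<Longrightarrow> \<bar>R p x q\<bar> \<le> \<epsilon> / 2 * (V q - V p)"
    using remainderE[OF assms(1) h] by metis
  obtain \<eta> where \<eta>: "\<eta> > 0"
    "\<And>p x q. \<lbrakk>a \<le> p; p \<le> x; x \<le> q; q \<le> b; q - p < \<eta>\<rbrakk> \<Longrightarrow> \<bar>S p x q\<bar> \<le> \<epsilon> / 2 * (V q - V p)"
    using remainderE[OF assms(2) h] by metis
  have "\<bar>R p x q + S p x q\<bar> \<le> \<epsilon> * (V q - V p)"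
    if "a \<le> p \<and> p \<le> x \<and> x \<le> q \<and> q \<le> b \<and> q - p < min \<delta> \<eta>" for p x q
    using \<delta>(2)[of p x q] \<eta>(2)[of p x q] that by (simp add: field_simps)
  then show "\<exists>\<delta>>0. \<forall>p x q. a \<le> p \<and> p \<le> x \<and> x \<le> q \<and> q \<le> b \<and> q - p < \<delta> \<longrightarrow>
     \<bar>R p x q + S p x q\<bar> \<le> \<epsilon> * (V q - V p)"
    using \<delta>(1) \<eta>(1) by (intro exI[of _ "min \<delta> \<eta>"]) simp
qed

lemma remainder_bound:
  assumes R: "remainder V a b R" and C: "C > 0"
    and le: "\<And>p x q. \<lbrakk>a \<le> p; p \<le> x; x \<le> q; q \<le> b\<rbrakk> \<Longrightarrow> \<bar>S p x q\<bar> \<le> C * \<bar>R p x q\<bar>"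
  shows "remainder V a b S"
  unfolding remainder_def
proof (intro allI impI)
  fix \<epsilon> :: real assume "\<epsilon> > 0"
  then have h: "\<epsilon> / C > 0" using C by simp
  obtain \<delta> where \<delta>: "\<delta> > 0"
    "\<And>p x q. \<lbrakk>a \<le> p; p \<le> x; x \<le> q; q \<le> b; q - p < \<delta>\<rbrakk> \<Longrightarrow> \<bar>R p x q\<bar> \<le> \<epsilon> / C * (V q - V p)"
    using remainderE[OF R h] by metis
  have "\<bar>S p x q\<bar> \<le> \<epsilon> * (V q - V p)"
    if "a \<le> p \<and> p \<le> x \<and> x \<le> q \<and> q \<le> b \<and> q - p < \<delta>" for p x q
  proof -
    have "\<bar>S p x q\<bar> \<le> C * \<bar>R p x q\<bar>" using le that by blast
    also have "\<dots> \<le> C * (\<epsilon> / C * (V q - V p))"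
      using \<delta>(2)[of p x q] that C by (intro mult_left_mono) auto
    finally show ?thesis using C by simp
  qed
  then show "\<exists>\<delta>>0. \<forall>p x q. a \<le> p \<and> p \<le> x \<and> x \<le> q \<and> q \<le> b \<and> q - p < \<delta> \<longrightarrow>
     \<bar>S p x q\<bar> \<le> \<epsilon> * (V q - V p)"
    using \<delta>(1) by blast
qed

lemma remainder_cmult: "remainder V a b R \<Longrightarrow> remainder V a b (\<lambda>p x q. c * R p x q)"
  by (rule remainder_bound[of V a b R "\<bar>c\<bar> + 1"]) (auto simp: abs_mult intro: mult_right_mono)

lemma remainder_diff:
  assumes "remainder V a b R" "remainder V a b S"
  shows "remainder V a b (\<lambda>p x q. R p x q - S p x q)"
  using remainder_add[OF assms(1) remainder_cmult[OF assms(2), of "-1"]] by simp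

lemma remainder_0:
  assumes "\<And>p q. \<lbrakk>a \<le> p; p \<le> q; q \<le> b\<rbrakk> \<Longrightarrow> V p \<le> V q"
  shows "remainder V a b (\<lambda>p x q. 0)"
  unfolding remainder_def using assms by (auto intro!: exI[of _ 1])

lemma remainder_sum:
  assumes V: "\<And>p q. \<lbrakk>a \<le> p; p \<le> q; q \<le> b\<rbrakk> \<Longrightarrow> V p \<le> V q"
    and R: "\<And>k. k \<in> J \<Longrightarrow> remainder V a b (R k)"
  shows "remainder V a b (\<lambda>p x q. \<Sum>k\<in>J. R k p x q)"
proof (cases "finite J")
  case True
  from this R show ?thesis
    by (induction J) (auto intro: remainder_0 V remainder_add)
next
  case False
  then show ?thesis using V by (simp add: remainder_0)
qed

text \<open>Increments which are controlled on short intervals are controlled on long ones.\<close>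

lemma vnorm_diff_local_global:
  fixes Z :: "real \<Rightarrow> rvec" and H :: "real \<Rightarrow> real"
  assumes "\<delta> > 0" "a \<le> b"
    and loc: "\<And>p q. \<lbrakk>a \<le> p; p \<le> q; q \<le> b; q - p < \<delta>\<rbrakk> \<Longrightarrow>
      vnorm e (\<lambda>j. Z q j - Z p j) \<le> H q - H p"
  shows "vnorm e (\<lambda>j. Z b j - Z a j) \<le> H b - H a"
proof -
  obtain n :: nat where n: "(b - a) / \<delta> < real n" using reals_Archimedean2 by blast
  then have n0: "0 < n" using assms(1,2) by (cases n) (auto simp: divide_simps)
  define h where "h = (b - a) / real n"
  have h: "0 \<le> h" "h < \<delta>" "real n * h = b - a"
    using n n0 assms(1,2) by (simp_all add: h_def field_simps)
  define u where "u k = a + real k * h" for k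
  have u: "a \<le> u k" "u k \<le> u (Suc k)" "u (Suc k) - u k < \<delta>" for k
    using h by (simp_all add: u_def distrib_right)
  have ub: "u k \<le> b" if "k \<le> n" for k
    using mult_right_mono[of "real k" "real n" h] that h by (simp add: u_def)
  have "vnorm e (\<lambda>j. Z (u k) j - Z a j) \<le> H (u k) - H a" if "k \<le> n" for k
    using that
  proof (induction k)
    case 0
    then show ?case by (simp add: u_def L2_set_def)
  next
    case (Suc k)
    have "vnorm e (\<lambda>j. Z (u (Suc k)) j - Z a j) \<le>
        vnorm e (\<lambda>j. Z (u (Suc k)) j - Z (u k) j) + vnorm e (\<lambda>j. Z (u k) j - Z a j)"
      by (rule vnorm_diff_triangle)
    also have "\<dots> \<le> (H (u (Suc k)) - H (u k)) + (H (u k) - H a)"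
      using Suc u ub by (intro add_mono[OF loc Suc.IH]) auto
    finally show ?case by simp
  qed
  from this[of n] show ?thesis using h by (simp add: u_def)
qed

lemma remainder_increment_zero:
  fixes H :: "real \<Rightarrow> real"
  assumes R: "remainder V a b (\<lambda>p x q. H q - H p)" and "a \<le> b"
  shows "H b = H a"
proof -
  have le: "\<bar>H b - H a\<bar> \<le> \<epsilon> * (V b - V a)" if \<epsilon>: "\<epsilon> > 0" for \<epsilon>
  proof -
    obtain \<delta> where \<delta>: "\<delta> > 0"
      "\<And>p x q. \<lbrakk>a \<le> p; p \<le> x; x \<le> q; q \<le> b; q - p < \<delta>\<rbrakk> \<Longrightarrow> \<bar>H q - H p\<bar> \<le> \<epsilon> * (V q - V p)"
      using remainderE[OF R \<epsilon>] by metis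
    have "vnorm 1 (\<lambda>j. H b - H a) \<le> \<epsilon> * V b - \<epsilon> * V a"
      by (rule vnorm_diff_local_global[where Z = "\<lambda>u j. H u" and H = "\<lambda>u. \<epsilon> * V u"])
         (use \<delta>(1) \<delta>(2) assms(2) in \<open>auto simp: lessThan_Suc algebra_simps\<close>)
    then show ?thesis by (simp add: lessThan_Suc algebra_simps)
  qed
  show ?thesis
  proof (rule ccontr)
    assume "H b \<noteq> H a"
    then have pos: "\<bar>H b - H a\<bar> > 0" by simp
    with le[of 1] have V: "V b - V a > 0" by simp
    from le[of "\<bar>H b - H a\<bar> / (2 * (V b - V a))"] pos V show False by (simp add: field_simps)
  qed
qed

text \<open>\<open>I\<close> is a primitive of \<open>f dg\<close> on \<open>[a, b]\<close>: the increments of \<open>I\<close> are the Riemann--Stieltjes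
  summands up to a remainder relative to a monotone \<open>V\<close>.\<close>

definition rs_primitive ::
    "(real \<Rightarrow> real) \<Rightarrow> real \<Rightarrow> real \<Rightarrow> (real \<Rightarrow> real) \<Rightarrow> (real \<Rightarrow> real) \<Rightarrow> (real \<Rightarrow> real) \<Rightarrow> bool" where
  "rs_primitive V a b f g I \<longleftrightarrow> remainder V a b (\<lambda>p x q. f x * (g q - g p) - (I q - I p))"

lemma has_rs_integral_primitive:
  assumes I: "rs_primitive V a b f g I" and "a \<le> b" "V a \<le> V b"
  shows "has_rs_integral f g a b (I b - I a)"
  unfolding has_rs_integral_def
proof (intro allI impI)
  fix \<epsilon> :: real assume "\<epsilon> > 0"
  define c where "c = \<epsilon> / (V b - V a + 1)"
  have c: "c > 0" and lt: "c * (V b - V a) < \<epsilon>"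
    using \<open>\<epsilon> > 0\<close> assms(3) by (auto simp: c_def field_simps add_pos_nonneg)
  obtain \<delta> where \<delta>: "\<delta> > 0"
    "\<And>p x q. \<lbrakk>a \<le> p; p \<le> x; x \<le> q; q \<le> b; q - p < \<delta>\<rbrakk> \<Longrightarrow>
      \<bar>f x * (g q - g p) - (I q - I p)\<bar> \<le> c * (V q - V p)"
    using remainderE[OF I[unfolded rs_primitive_def] c] by metis
  have "\<bar>(\<Sum>(x, K)\<in>P. f x * (g (Sup K) - g (Inf K))) - (I b - I a)\<bar> < \<epsilon>"
    if P: "P tagged_division_of {a..b}" "(\<lambda>x. ball x (\<delta> / 2)) fine P" for P
  proof -
    have "\<bar>(\<Sum>(x, K)\<in>P. f x * (g (Sup K) - g (Inf K))) - (I b - I a)\<bar> =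
        \<bar>\<Sum>(x, K)\<in>P. f x * (g (Sup K) - g (Inf K)) - (I (Sup K) - I (Inf K))\<bar>"
    proof -
      have "I b - I a = (\<Sum>(x, K)\<in>P. I (Sup K) - I (Inf K))"
        by (rule additive_tagged_division_1[OF \<open>a \<le> b\<close> P(1), symmetric])
      then show ?thesis by (simp only: case_prod_unfold sum_subtractf)
    qed
    also have "\<dots> \<le> (\<Sum>(x, K)\<in>P. c * (V (Sup K) - V (Inf K)))"
    proof (rule order_trans[OF sum_abs sum_mono], clarify)
      fix x K assume xK: "(x, K) \<in> P"
      obtain p q where K: "K = {p..q}" using tagged_division_ofD(4)[OF P(1) xK] by auto
      have x: "x \<in> K" "K \<subseteq> {a..b}" using tagged_division_ofD(2,3)[OF P(1) xK] by auto
      have "K \<subseteq> ball x (\<delta> / 2)" using P(2) xK by (rule fineD)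
      moreover have "p \<in> K" "q \<in> K" using K x(1) by auto
      ultimately have "p \<in> ball x (\<delta> / 2)" "q \<in> ball x (\<delta> / 2)" by blast+
      then have "q - p < \<delta>" unfolding mem_ball dist_real_def by linarith
      then show "\<bar>f x * (g (Sup K) - g (Inf K)) - (I (Sup K) - I (Inf K))\<bar> \<le>
          c * (V (Sup K) - V (Inf K))"
        using \<delta>(2)[of p x q] K x by simp
    qed
    also have "\<dots> = c * (V b - V a)"
    proof -
      have "V b - V a = (\<Sum>(x, K)\<in>P. V (Sup K) - V (Inf K))"
        by (rule additive_tagged_division_1[OF \<open>a \<le> b\<close> P(1), symmetric])
      then show ?thesis by (simp only: case_prod_unfold sum_distrib_left)
    qed
    finally show ?thesis using lt by simp
  qed
  then show "\<exists>\<delta>>0. \<forall>p. p tagged_division_of {a..b} \<and> (\<lambda>x. ball x \<delta>) fine p \<longrightarrow>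
      \<bar>(\<Sum>(x, K)\<in>p. f x * (g (Sup K) - g (Inf K))) - (I b - I a)\<bar> < \<epsilon>"
    using \<delta>(1) by (intro exI[of _ "\<delta> / 2"]) simp
qed

lemma has_rs_integralE:
  assumes "has_rs_integral f g a b I" "\<epsilon> > 0"
  obtains \<delta> where "\<delta> > 0"
    "\<And>p. \<lbrakk>p tagged_division_of {a..b}; (\<lambda>x. ball x \<delta>) fine p\<rbrakk> \<Longrightarrow>
        \<bar>(\<Sum>(x, K)\<in>p. f x * (g (Sup K) - g (Inf K))) - I\<bar> < \<epsilon>"
  using assms unfolding has_rs_integral_def by meson

lemma has_rs_integral_unique:
  assumes "has_rs_integral f g a b I" "has_rs_integral f g a b J"
  shows "I = J"
proof (rule ccontr)
  assume "I \<noteq> J"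
  then have pos: "\<bar>I - J\<bar> / 2 > 0" by simp
  obtain \<delta> where \<delta>: "\<delta> > 0"
    and I: "\<And>p. \<lbrakk>p tagged_division_of {a..b}; (\<lambda>x. ball x \<delta>) fine p\<rbrakk> \<Longrightarrow>
        \<bar>(\<Sum>(x, K)\<in>p. f x * (g (Sup K) - g (Inf K))) - I\<bar> < \<bar>I - J\<bar> / 2"
    by (rule has_rs_integralE[OF assms(1) pos]) (rule that)
  obtain \<eta> where \<eta>: "\<eta> > 0"
    and J: "\<And>p. \<lbrakk>p tagged_division_of {a..b}; (\<lambda>x. ball x \<eta>) fine p\<rbrakk> \<Longrightarrow>
        \<bar>(\<Sum>(x, K)\<in>p. f x * (g (Sup K) - g (Inf K))) - J\<bar> < \<bar>I - J\<bar> / 2"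
    by (rule has_rs_integralE[OF assms(2) pos]) (rule that)
  have "gauge (\<lambda>x. ball x (min \<delta> \<eta>))" using \<delta> \<eta> by (intro gauge_ball) simp
  then obtain p where p: "p tagged_division_of {a..b}" "(\<lambda>x. ball x (min \<delta> \<eta>)) fine p"
    by (rule fine_division_exists_real)
  then have fine: "(\<lambda>x. ball x \<delta>) fine p" "(\<lambda>x. ball x \<eta>) fine p"
    by (auto simp: fine_def subset_eq)
  define S where "S = (\<Sum>(x, K)\<in>p. f x * (g (Sup K) - g (Inf K)))"
  have "\<bar>S - I\<bar> < \<bar>I - J\<bar> / 2" "\<bar>S - J\<bar> < \<bar>I - J\<bar> / 2"
    unfolding S_def by (rule I[OF p(1) fine(1)], rule J[OF p(1) fine(2)])
  then show False by argo
qed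

lemma rs_integral_eq:
  assumes I: "rs_primitive V a b f g I" and st: "a \<le> s" "s \<le> t" "t \<le> b" and V: "V s \<le> V t"
  shows "rs_integral f g s t = I t - I s"
proof -
  have "rs_primitive V s t f g I"
    using I unfolding rs_primitive_def by (rule remainder_subinterval[OF _ st(1,3)])
  then have "has_rs_integral f g s t (I t - I s)"
    using st V by (intro has_rs_integral_primitive[of V]) auto
  then show ?thesis
    unfolding rs_integral_def by (intro the_equality) (auto intro: has_rs_integral_unique)
qed

lemma rs_primitive_continuous:
  assumes I: "rs_primitive V a b f g I"
    and g: "continuous_on {a..b} g" and V: "continuous_on {a..b} V"
  shows "continuous_on {a..b} I"
  unfolding continuous_on_def
proof
  fix u assume u: "u \<in> {a..b}"
  obtain \<delta> where \<delta>: "\<delta> > 0"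
    "\<And>p x q. \<lbrakk>a \<le> p; p \<le> x; x \<le> q; q \<le> b; q - p < \<delta>\<rbrakk> \<Longrightarrow>
      \<bar>f x * (g q - g p) - (I q - I p)\<bar> \<le> 1 * (V q - V p)"
    using remainderE[OF I[unfolded rs_primitive_def] zero_less_one] by metis
  have "\<forall>\<^sub>F v in at u within {a..b}. v \<in> {a..b} \<and> dist v u < \<delta>"
    unfolding eventually_at using \<delta>(1) by auto
  then have ev: "\<forall>\<^sub>F v in at u within {a..b}.
      norm (I v - I u) \<le> \<bar>f u\<bar> * \<bar>g v - g u\<bar> + \<bar>V v - V u\<bar>"
  proof eventually_elim
    case (elim v)
    have "\<bar>f u * (g v - g u) - (I v - I u)\<bar> \<le> \<bar>V v - V u\<bar>"
    proof (cases "u \<le> v")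
      case True
      have "\<bar>f u * (g v - g u) - (I v - I u)\<bar> \<le> 1 * (V v - V u)"
        by (rule \<delta>(2)) (use True elim u in \<open>auto simp: dist_real_def\<close>)
      then show ?thesis by (rule order_trans) simp
    next
      case False
      have "f u * (g v - g u) - (I v - I u) = - (f u * (g u - g v) - (I u - I v))"
        by (simp add: algebra_simps)
      moreover have "\<bar>f u * (g u - g v) - (I u - I v)\<bar> \<le> 1 * (V u - V v)"
        by (rule \<delta>(2)) (use False elim u in \<open>auto simp: dist_real_def\<close>)
      ultimately show ?thesis by simp
    qed
    moreover have "\<bar>f u * (g v - g u)\<bar> = \<bar>f u\<bar> * \<bar>g v - g u\<bar>" by (rule abs_mult)
    ultimately show ?case unfolding real_norm_def by linarith
  qed
  have "((\<lambda>v. \<bar>f u\<bar> * \<bar>g v - g u\<bar> + \<bar>V v - V u\<bar>) \<longlongrightarrow> \<bar>f u\<bar> * \<bar>g u - g u\<bar> + \<bar>V u - V u\<bar>)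
      (at u within {a..b})"
    using g V u unfolding continuous_on_def by (intro tendsto_intros) auto
  then have "((\<lambda>v. I v - I u) \<longlongrightarrow> 0) (at u within {a..b})"
    using ev by (intro Lim_null_comparison[OF ev]) simp
  then show "(I \<longlongrightarrow> I u) (at u within {a..b})" by (simp add: LIM_zero_iff)
qed

text \<open>For monotone integrators the primitive is a Lebesgue integral against the
  Lebesgue--Stieltjes measure of the integrator, extended to the line by constants.\<close>

lemma rs_primitive_exists_mono:
  fixes f F :: "real \<Rightarrow> real"
  assumes "a \<le> b" and f: "continuous_on {a..b} f" and F: "continuous_on {a..b} F"
    and mono: "\<And>p q. \<lbrakk>a \<le> p; p \<le> q; q \<le> b\<rbrakk> \<Longrightarrow> F p \<le> F q"
  shows "\<exists>I. rs_primitive F a b f F I"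
proof -
  define k where "k u = max a (min b u)" for u
  have k: "k u \<in> {a..b}" "u \<in> {a..b} \<Longrightarrow> k u = u" "u \<le> v \<Longrightarrow> k u \<le> k v" for u v
    using \<open>a \<le> b\<close> by (auto simp: k_def)
  have k_cont: "continuous_on UNIV k" unfolding k_def by (intro continuous_intros)
  define f' F' where "f' = f \<circ> k" and "F' = F \<circ> k"
  have f': "continuous_on UNIV f'" unfolding f'_def
    by (rule continuous_on_compose[OF k_cont]) (rule continuous_on_subset[OF f], use k in auto)
  have F': "continuous_on UNIV F'" unfolding F'_def
    by (rule continuous_on_compose[OF k_cont]) (rule continuous_on_subset[OF F], use k in auto)
  have F'_mono: "F' u \<le> F' v" if "u \<le> v" for u v
    using mono[of "k u" "k v"] k that by (simp add: F'_def)
  define M where "M = interval_measure F'"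
  have right: "continuous (at_right u) F'" for u
    using F' by (simp add: continuous_on_eq_continuous_at continuous_at_imp_continuous_within)
  have emeas: "emeasure M {p<..q} = ennreal (F' q - F' p)" if "p \<le> q" for p q
    unfolding M_def using that F'_mono right by (rule emeasure_interval_measure_Ioc)
  have meas: "measure M {p<..q} = F' q - F' p" if "p \<le> q" for p q
    unfolding M_def using that F'_mono right by (rule measure_interval_measure_Ioc)
  have sets[measurable_cong]: "sets M = sets borel" by (simp add: M_def)
  have f'_meas: "f' \<in> borel_measurable M"
    using borel_measurable_continuous_onI[OF f'] sets by (simp cong: measurable_cong_sets)
  obtain B where B: "\<And>u. \<bar>f' u\<bar> \<le> B"
  proof -
    have "bounded (f ` {a..b})" using compact_continuous_image[OF f] compact_imp_bounded by auto
    then obtain B where "\<forall>y\<in>f ` {a..b}. \<bar>y\<bar> \<le> B" by (auto simp: bounded_iff)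
    then show ?thesis using that[of B] k(1) by (auto simp: f'_def)
  qed
  have int: "set_integrable M {p<..q} (\<lambda>u. h u)"
    if "h \<in> borel_measurable M" "\<And>u. \<bar>h u\<bar> \<le> C" "p \<le> q" for h :: "real \<Rightarrow> real" and C p q
    unfolding set_integrable_def
  proof (rule integrableI_bounded_set[of "{p<..q}" _ _ C])
    show "emeasure M {p<..q} < \<infinity>" using emeas[OF that(3)] by simp
    show "(\<lambda>u. indicat_real {p<..q} u *\<^sub>R h u) \<in> borel_measurable M"
      using that(1) sets by (intro borel_measurable_scaleR borel_measurable_indicator) auto
  qed (use that sets in \<open>auto simp: indicator_def\<close>)
  define I where "I u = (LINT v:{a<..u}|M. f' v)" for u
  have I_diff: "I q - I p = (LINT v:{p<..q}|M. f' v)" if "a \<le> p" "p \<le> q" for p q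
  proof -
    have "{a<..q} = {a<..p} \<union> {p<..q}" using that by auto
    then have "I q = I p + (LINT v:{p<..q}|M. f' v)"
      unfolding I_def using int[OF f'_meas B] that by (simp, intro set_integral_Un) auto
    then show ?thesis by simp
  qed
  have "remainder F a b (\<lambda>p x q. f x * (F q - F p) - (I q - I p))"
    unfolding remainder_def
  proof (intro allI impI)
    fix \<epsilon> :: real assume "\<epsilon> > 0"
    have "uniformly_continuous_on {a..b} f" using f by (simp add: compact_uniformly_continuous)
    then obtain \<delta> where \<delta>: "\<delta> > 0" 
      "\<And>u v. \<lbrakk>u \<in> {a..b}; v \<in> {a..b}; \<bar>v - u\<bar> < \<delta>\<rbrakk> \<Longrightarrow> \<bar>f v - f u\<bar> < \<epsilon>"
      using \<open>\<epsilon> > 0\<close> unfolding uniformly_continuous_on_def dist_real_def by metis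
    have "\<bar>f x * (F q - F p) - (I q - I p)\<bar> \<le> \<epsilon> * (F q - F p)"
      if h: "a \<le> p \<and> p \<le> x \<and> x \<le> q \<and> q \<le> b \<and> q - p < \<delta>" for p x q
    proof -
      have pq: "p \<le> q" using h by simp
      have Fpq: "F q - F p = measure M {p<..q}"
        using meas[OF pq] k(2) h by (simp add: F'_def)
      have c: "(LINT v:{p<..q}|M. c) = (F q - F p) * c" for c :: real
        unfolding Fpq using sets by (subst set_integral_const) (auto simp: emeas[OF pq])
      have i1: "set_integrable M {p<..q} (\<lambda>u. f x)" and i2: "set_integrable M {p<..q} f'"
        and i4: "set_integrable M {p<..q} (\<lambda>u. \<epsilon>)"
        using int[of "\<lambda>u. f x" "\<bar>f x\<bar>"] int[OF f'_meas B] int[of "\<lambda>u. \<epsilon>" "\<bar>\<epsilon>\<bar>"] pq by auto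
      have i3: "set_integrable M {p<..q} (\<lambda>u. f x - f' u)" by (rule set_integral_diff[OF i1 i2])
      have "f x * (F q - F p) - (I q - I p) = (LINT v:{p<..q}|M. f x - f' v)"
        using set_integral_diff(2)[OF i1 i2] c I_diff[of p q] h by (simp add: mult.commute)
      moreover have "\<bar>LINT v:{p<..q}|M. f x - f' v\<bar> \<le> (LINT v:{p<..q}|M. \<bar>f x - f' v\<bar>)"
        using set_integral_norm_bound[OF i3] by simp
      moreover have "(LINT v:{p<..q}|M. \<bar>f x - f' v\<bar>) \<le> (LINT v:{p<..q}|M. \<epsilon>)"
      proof (rule set_integral_mono[OF set_integrable_abs[OF i3] i4])
        fix v assume "v \<in> {p<..q}"
        then show "\<bar>f x - f' v\<bar> \<le> \<epsilon>"
          using \<delta>(2)[of v x] h k(2)[of v] by (force simp: f'_def)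
      qed
      ultimately show ?thesis using c[of \<epsilon>] by (simp add: mult.commute)
    qed
    then show "\<exists>\<delta>>0. \<forall>p x q. a \<le> p \<and> p \<le> x \<and> x \<le> q \<and> q \<le> b \<and> q - p < \<delta> \<longrightarrow>
      \<bar>f x * (F q - F p) - (I q - I p)\<bar> \<le> \<epsilon> * (F q - F p)" using \<delta>(1) by blast
  qed
  then show ?thesis unfolding rs_primitive_def by blast
qed

lemma rs_primitive_exists:
  fixes f g V :: "real \<Rightarrow> real"
  assumes "a \<le> b" and f: "continuous_on {a..b} f" and g: "continuous_on {a..b} g"
    and V: "continuous_on {a..b} V"
    and le: "\<And>p q. \<lbrakk>a \<le> p; p \<le> q; q \<le> b\<rbrakk> \<Longrightarrow> \<bar>g q - g p\<bar> \<le> V q - V p"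
  shows "\<exists>I. rs_primitive V a b f g I"
proof -
  \<comment> \<open>\<open>g\<close> is the difference of the monotone functions \<open>V\<close> and \<open>V - g\<close>\<close>
  let ?W = "\<lambda>u. V u - g u"
  obtain I where I: "rs_primitive V a b f V I"
    using rs_primitive_exists_mono[OF \<open>a \<le> b\<close> f V] le by (meson abs_ge_zero diff_ge_0_iff_ge order_trans)
  have "continuous_on {a..b} ?W" by (intro continuous_intros V g)
  moreover have "?W p \<le> ?W q" if "a \<le> p" "p \<le> q" "q \<le> b" for p q using le[OF that] by linarith
  ultimately obtain J where J: "rs_primitive ?W a b f ?W J"
    using rs_primitive_exists_mono[OF \<open>a \<le> b\<close> f, of ?W] by blast
  have "remainder V a b (\<lambda>p x q. f x * (?W q - ?W p) - (J q - J p))"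
    unfolding remainder_def
  proof (intro allI impI)
    fix \<epsilon> :: real assume "\<epsilon> > 0"
    then have h: "\<epsilon> / 2 > 0" by simp
    obtain \<delta> where \<delta>: "\<delta> > 0" "\<And>p x q. \<lbrakk>a \<le> p; p \<le> x; x \<le> q; q \<le> b; q - p < \<delta>\<rbrakk> \<Longrightarrow>
      \<bar>f x * (?W q - ?W p) - (J q - J p)\<bar> \<le> \<epsilon> / 2 * (?W q - ?W p)"
      using remainderE[OF J[unfolded rs_primitive_def] h] by metis
    have "\<bar>f x * (?W q - ?W p) - (J q - J p)\<bar> \<le> \<epsilon> * (V q - V p)"
      if "a \<le> p \<and> p \<le> x \<and> x \<le> q \<and> q \<le> b \<and> q - p < \<delta>" for p x q
    proof -
      have "\<bar>f x * (?W q - ?W p) - (J q - J p)\<bar> \<le> \<epsilon> / 2 * (?W q - ?W p)"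
        using \<delta>(2) that by blast
      also have "\<dots> \<le> \<epsilon> / 2 * (2 * (V q - V p))"
        using le[of p q] that h by (intro mult_left_mono) auto
      also have "\<dots> = \<epsilon> * (V q - V p)" by simp
      finally show ?thesis .
    qed
    then show "\<exists>\<delta>>0. \<forall>p x q. a \<le> p \<and> p \<le> x \<and> x \<le> q \<and> q \<le> b \<and> q - p < \<delta> \<longrightarrow>
      \<bar>f x * (?W q - ?W p) - (J q - J p)\<bar> \<le> \<epsilon> * (V q - V p)" using \<delta>(1) by blast
  qed
  from remainder_diff[OF I[unfolded rs_primitive_def] this]
  have "rs_primitive V a b f g (\<lambda>u. I u - J u)"
    unfolding rs_primitive_def by (simp add: algebra_simps)
  then show ?thesis by blast
qed


section \<open>Elementary inequalities\<close>

text \<open>The tangent line inequality for \<open>x \<mapsto> x^(n + 1)\<close> on the nonnegative half-line.\<close>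

lemma power_increment_lower:
  fixes a b :: real
  assumes "0 \<le> a" "0 \<le> b"
  shows "real (Suc n) * a ^ n * (b - a) \<le> b ^ Suc n - a ^ Suc n"
proof (induction n)
  case (Suc n)
  have "b * (real (Suc n) * a ^ n * (b - a)) \<le> b * (b ^ Suc n - a ^ Suc n)"
    using Suc assms(2) by (rule mult_left_mono)
  moreover have "0 \<le> real (Suc n) * a ^ n * (b - a)\<^sup>2" using assms(1) by simp
  ultimately show ?case by (simp add: algebra_simps power2_eq_square)
qed simp

lemma exp_term_increment:
  fixes r v w :: real
  assumes "0 \<le> r" "0 \<le> v" "v \<le> w"
  shows "(r * v) ^ n / fact n * (r * (w - v)) \<le> (r * w) ^ Suc n / fact (Suc n) - (r * v) ^ Suc n / fact (Suc n)"
proof -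
  have "real (Suc n) * (r * v) ^ n * (r * w - r * v) / fact (Suc n) \<le>
      ((r * w) ^ Suc n - (r * v) ^ Suc n) / fact (Suc n)"
    using assms by (intro divide_right_mono power_increment_lower) auto
  moreover have "real (Suc n) * (r * v) ^ n * (r * w - r * v) / fact (Suc n) =
      (r * v) ^ n / fact n * (r * (w - v))"
    by (simp add: field_simps del: of_nat_Suc)
  ultimately show ?thesis by (simp only: diff_divide_distrib)
qed

lemma exp_terms_summable: "summable (\<lambda>n. x ^ n / fact n :: real)"
  using summable_exp_generic[of x] by (simp add: divide_inverse mult.commute)

lemma exp_terms_sum: "(\<Sum>n. x ^ n / fact n) = exp (x :: real)"
  by (simp add: exp_def divide_inverse mult.commute)

lemma exp_terms_tendsto: "(\<lambda>n. x ^ n / fact n :: real) \<longlonglongrightarrow> 0"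
  by (rule summable_LIMSEQ_zero[OF exp_terms_summable])

lemma exp_partial_sum_le:
  assumes "0 \<le> (x :: real)" "finite J"
  shows "(\<Sum>n\<in>J. x ^ n / fact n) \<le> exp x"
  unfolding exp_terms_sum[symmetric] using assms by (intro sum_le_suminf exp_terms_summable) auto

lemma exp_tail_le:
  assumes "0 \<le> (x :: real)"
  shows "(\<Sum>n=Suc N..M. x ^ n / fact n) \<le> x ^ Suc N / fact (Suc N) * exp x"
proof -
  have "(\<Sum>n=Suc N..M. x ^ n / fact n) = (\<Sum>k\<in>(\<lambda>n. n - Suc N) ` {Suc N..M}. x ^ (Suc N + k) / fact (Suc N + k))"
    by (subst sum.reindex) (auto simp: inj_on_def simp del: fact_Suc power_Suc intro!: sum.cong)
  also have "\<dots> \<le> (\<Sum>k\<in>(\<lambda>n. n - Suc N) ` {Suc N..M}. x ^ Suc N / fact (Suc N) * (x ^ k / fact k))"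
  proof (rule sum_mono)
    fix k
    have "fact (Suc N) * fact k \<le> (fact (Suc N + k) :: nat)"
      by (rule dvd_imp_le[OF fact_fact_dvd_fact]) simp
    then have "real (fact (Suc N) * fact k) \<le> real (fact (Suc N + k))" by (rule of_nat_mono)
    then have "fact (Suc N) * fact k \<le> (fact (Suc N + k) :: real)" by (simp only: of_nat_mult of_nat_fact)
    then have "x ^ (Suc N + k) / fact (Suc N + k) \<le> x ^ (Suc N + k) / (fact (Suc N) * fact k)"
      using assms by (intro divide_left_mono) auto
    then show "x ^ (Suc N + k) / fact (Suc N + k) \<le> x ^ Suc N / fact (Suc N) * (x ^ k / fact k)"
      by (simp only: power_add times_divide_times_eq)
  qed
  also have "\<dots> = x ^ Suc N / fact (Suc N) * (\<Sum>k\<in>(\<lambda>n. n - Suc N) ` {Suc N..M}. x ^ k / fact k)"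
    by (simp only: sum_distrib_left)
  also have "\<dots> \<le> x ^ Suc N / fact (Suc N) * exp x"
    using assms by (intro mult_left_mono exp_partial_sum_le) auto
  finally show ?thesis .
qed


section \<open>Linear vector fields\<close>

lemma lin_app_diff:
  "lin_app d e A x (\<lambda>k. v k - w k) j = lin_app d e A x v j - lin_app d e A x w j"
  by (simp add: lin_app_def right_diff_distrib sum_subtractf)

lemma fold_lin_app_diff:
  "fold (\<lambda>i. lin_app d e A (basis_vec i)) w (\<lambda>k. y k - z k) j =
    fold (\<lambda>i. lin_app d e A (basis_vec i)) w y j - fold (\<lambda>i. lin_app d e A (basis_vec i)) w z j"
proof (induction w arbitrary: y z)
  case (Cons i w)
  have "lin_app d e A (basis_vec i) (\<lambda>k. y k - z k) =
      (\<lambda>k. lin_app d e A (basis_vec i) y k - lin_app d e A (basis_vec i) z k)"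
    by (simp add: lin_app_diff fun_eq_iff)
  then show ?case by (simp add: Cons.IH)
qed simp

lemma tensor_app_diff:
  "tensor_app d e A n (\<lambda>k. y k - z k) S j = tensor_app d e A n y S j - tensor_app d e A n z S j"
  by (simp add: tensor_app_def fold_lin_app_diff right_diff_distrib sum_subtractf)

lemma vnorm_lin_app_le: "vnorm e (lin_app d e A x v) \<le> frob d e A * vnorm d x * vnorm e v"
proof -
  let ?P = "{..<d} \<times> {..<e}"
  have xv: "L2_set (\<lambda>(i, k). x i * v k) ?P = vnorm d x * vnorm e v"
    by (simp add: L2_set_def power_mult_distrib real_sqrt_mult[symmetric]
        sum_product sum.cartesian_product case_prod_unfold)
  have "\<bar>lin_app d e A x v j\<bar> \<le> L2_set (\<lambda>(i, k). A i j k) ?P * (vnorm d x * vnorm e v)" for j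
  proof -
    have "lin_app d e A x v j = (\<Sum>p\<in>?P. (\<lambda>(i, k). A i j k) p * (\<lambda>(i, k). x i * v k) p)"
      by (simp add: lin_app_def sum_distrib_left sum.cartesian_product case_prod_unfold mult_ac)
    also have "\<bar>\<dots>\<bar> \<le> (\<Sum>p\<in>?P. \<bar>(\<lambda>(i, k). A i j k) p\<bar> * \<bar>(\<lambda>(i, k). x i * v k) p\<bar>)"
      by (rule order_trans[OF sum_abs]) (simp add: abs_mult)
    also have "\<dots> \<le> L2_set (\<lambda>(i, k). A i j k) ?P * L2_set (\<lambda>(i, k). x i * v k) ?P"
      by (rule L2_set_mult_ineq)
    finally show ?thesis by (simp only: xv)
  qed
  then have "vnorm e (\<lambda>j. \<bar>lin_app d e A x v j\<bar>) \<le>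
      vnorm e (\<lambda>j. L2_set (\<lambda>(i, k). A i j k) ?P * (vnorm d x * vnorm e v))"
    by (intro L2_set_mono) auto
  also have "\<dots> = vnorm e (\<lambda>j. L2_set (\<lambda>(i, k). A i j k) ?P) * (vnorm d x * vnorm e v)"
    by (simp add: L2_set_left_distrib)
  also have "vnorm e (\<lambda>j. L2_set (\<lambda>(i, k). A i j k) ?P) = frob d e A"
  proof -
    have "(\<Sum>j<e. \<Sum>p\<in>?P. (case p of (i, k) \<Rightarrow> A i j k)\<^sup>2) =
        (\<Sum>j<e. \<Sum>i<d. \<Sum>k<e. (A i j k)\<^sup>2)"
      by (simp add: sum.cartesian_product case_prod_unfold)
    also have "\<dots> = (\<Sum>i<d. \<Sum>j<e. \<Sum>k<e. (A i j k)\<^sup>2)" by (rule sum.swap)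
    also have "\<dots> = (\<Sum>p\<in>{..<d} \<times> {..<e} \<times> {..<e}. (case p of (i, j, k) \<Rightarrow> A i j k)\<^sup>2)"
      by (simp add: sum.cartesian_product case_prod_unfold)
    finally show ?thesis
      unfolding frob_def L2_set_def by (simp add: sum_nonneg)
  qed
  finally show ?thesis by (simp add: L2_set_def mult.assoc)
qed

lemma vnorm_sum_le: "finite J \<Longrightarrow> vnorm e (\<lambda>j. \<Sum>n\<in>J. f n j) \<le> (\<Sum>n\<in>J. vnorm e (f n))"
proof (induction J rule: finite_induct)
  case (insert n J)
  then show ?case
    using vnorm_triangle[of "f n" "\<lambda>j. \<Sum>n\<in>J. f n j" e] by simp
qed (simp add: L2_set_def)


section \<open>Linear controlled differential equations\<close>

text \<open>A path of bounded variation together with a linear vector field of norm at most \<open>r\<close>.\<close>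

locale linear_cde = bv_path +
  fixes e :: nat and A :: lin_field and r :: real
  assumes A: "frob d e A \<le> r"
begin

text \<open>\<open>drives s t Y Z\<close> expresses \<open>dZ = A(dX) Y\<close> on \<open>[s, t]\<close> through increments, so that
  it is manifestly linear in \<open>(Y, Z)\<close> and passes to subintervals.\<close>

definition drives :: "real \<Rightarrow> real \<Rightarrow> (real \<Rightarrow> rvec) \<Rightarrow> (real \<Rightarrow> rvec) \<Rightarrow> bool" where
  "drives s t Y Z \<longleftrightarrow> (\<forall>j<e. remainder V s t
     (\<lambda>p x q. lin_app d e A (\<lambda>i. X q i - X p i) (Y x) j - (Z q j - Z p j)))"

lemma r_nonneg: "0 \<le> r"
  using A L2_set_nonneg order_trans unfolding frob_def by blast

lemma drives_subinterval: "\<lbrakk>drives s t Y Z; s \<le> s'; t' \<le> t\<rbrakk> \<Longrightarrow> drives s' t' Y Z"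
  unfolding drives_def by (blast intro: remainder_subinterval)

lemma drives_diff:
  assumes "drives s t Y Z" "drives s t Y' Z'"
  shows "drives s t (\<lambda>u k. Y u k - Y' u k) (\<lambda>u j. Z u j - Z' u j)"
  unfolding drives_def
proof (intro allI impI)
  fix j assume "j < e"
  with assms have "remainder V s t (\<lambda>p x q.
      (lin_app d e A (\<lambda>i. X q i - X p i) (Y x) j - (Z q j - Z p j)) -
      (lin_app d e A (\<lambda>i. X q i - X p i) (Y' x) j - (Z' q j - Z' p j)))"
    by (intro remainder_diff[where R = "\<lambda>p x q. lin_app d e A (\<lambda>i. X q i - X p i) (Y x) j - (Z q j - Z p j)"])
      (simp_all add: drives_def)
  moreover have "(a - (z - w)) - (a' - (z' - w')) = (a - a') - ((z - z') - (w - w'))"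
    for a a' z z' w w' :: real by simp
  ultimately show "remainder V s t (\<lambda>p x q.
      lin_app d e A (\<lambda>i. X q i - X p i) (\<lambda>k. Y x k - Y' x k) j -
      ((Z q j - Z' q j) - (Z p j - Z' p j)))"
    by (simp only: lin_app_diff)
qed

lemma drives_cong:
  assumes D: "drives s t Y Z" and "\<And>u j. \<lbrakk>s \<le> u; u \<le> t; j < e\<rbrakk> \<Longrightarrow> Z' u j = c j + Z u j"
  shows "drives s t Y Z'"
  unfolding drives_def
proof (intro allI impI)
  fix j assume "j < e"
  with D have "remainder V s t
     (\<lambda>p x q. lin_app d e A (\<lambda>i. X q i - X p i) (Y x) j - (Z q j - Z p j))"
    by (simp add: drives_def)
  then show "remainder V s t
     (\<lambda>p x q. lin_app d e A (\<lambda>i. X q i - X p i) (Y x) j - (Z' q j - Z' p j))"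
    by (rule remainder_bound[of _ _ _ _ 1]) (use assms(2) \<open>j < e\<close> in auto)
qed

text \<open>The basic estimate: with tags at left endpoints, a bound of the Riemann sums by telescoping
  increments of \<open>G\<close> passes to the integral.\<close>

lemma drives_growth:
  assumes D: "drives s t Y Z" and st: "0 \<le> s" "s \<le> t" "t \<le> T"
    and G: "\<And>p q. \<lbrakk>s \<le> p; p \<le> q; q \<le> t\<rbrakk> \<Longrightarrow> r * (V q - V p) * vnorm e (Y p) \<le> G q - G p"
  shows "vnorm e (\<lambda>j. Z t j - Z s j) \<le> G t - G s"
proof -
  let ?R = "\<lambda>j p x q. lin_app d e A (\<lambda>i. X q i - X p i) (Y x) j - (Z q j - Z p j)"
  have mono: "V p \<le> V q" if "s \<le> p" "p \<le> q" "q \<le> t" for p q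
    using V_mono[of p q] st that by auto
  have R: "remainder V s t (\<lambda>p x q. \<Sum>j<e. \<bar>?R j p x q\<bar>)"
  proof (rule remainder_sum[OF mono])
    fix j assume "j \<in> {..<e}"
    with D have "remainder V s t (?R j)" by (simp add: drives_def)
    then show "remainder V s t (\<lambda>p x q. \<bar>?R j p x q\<bar>)"
      by (rule remainder_bound[of _ _ _ _ 1]) auto
  qed
  have est: "vnorm e (\<lambda>j. Z t j - Z s j) \<le> G t - G s + \<epsilon> * (V t - V s)" if \<epsilon>: "\<epsilon> > 0" for \<epsilon>
  proof -
    obtain \<delta> where \<delta>: "\<delta> > 0"
      "\<And>p x q. \<lbrakk>s \<le> p; p \<le> x; x \<le> q; q \<le> t; q - p < \<delta>\<rbrakk> \<Longrightarrow>
        \<bar>\<Sum>j<e. \<bar>?R j p x q\<bar>\<bar> \<le> \<epsilon> * (V q - V p)"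
      by (rule remainderE[OF R \<epsilon>]) (rule that)
    have "vnorm e (\<lambda>j. Z t j - Z s j) \<le> (G t + \<epsilon> * V t) - (G s + \<epsilon> * V s)"
    proof (rule vnorm_diff_local_global[OF \<delta>(1) st(2)])
      fix p q assume pq: "s \<le> p" "p \<le> q" "q \<le> t" "q - p < \<delta>"
      let ?a = "lin_app d e A (\<lambda>i. X q i - X p i) (Y p)"
      have "vnorm e (\<lambda>j. Z q j - Z p j) \<le> vnorm e ?a + vnorm e (\<lambda>j. ?R j p p q)"
        using vnorm_triangle[of ?a "\<lambda>j. - ?R j p p q" e] by (simp add: L2_set_def power2_commute)
      also have "vnorm e ?a \<le> frob d e A * vnorm d (\<lambda>i. X q i - X p i) * vnorm e (Y p)"
        by (rule vnorm_lin_app_le)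
      also have "\<dots> \<le> r * (V q - V p) * vnorm e (Y p)"
        using A r_nonneg vnorm_le_V_diff[of p q] pq st
        by (intro mult_right_mono mult_mono) auto
      also have "\<dots> \<le> G q - G p" using G pq by blast
      also have "vnorm e (\<lambda>j. ?R j p p q) \<le> (\<Sum>j<e. \<bar>?R j p p q\<bar>)" by (rule L2_set_le_sum_abs)
      also have "\<dots> \<le> \<epsilon> * (V q - V p)" using \<delta>(2)[of p p q] pq by simp
      finally show "vnorm e (\<lambda>j. Z q j - Z p j) \<le> (G q + \<epsilon> * V q) - (G p + \<epsilon> * V p)"
        by (simp add: algebra_simps)
    qed
    then show ?thesis by (simp add: algebra_simps)
  qed
  show ?thesis
  proof (rule field_le_epsilon)
    fix \<epsilon> :: real assume "\<epsilon> > 0"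
    have nn: "V t - V s \<ge> 0" using mono[of s t] st by simp
    have "\<epsilon> / (V t - V s + 1) * (V t - V s) \<le> \<epsilon>"
      using \<open>\<epsilon> > 0\<close> nn by (simp add: divide_simps)
    moreover have "\<epsilon> / (V t - V s + 1) > 0" using \<open>\<epsilon> > 0\<close> nn by simp
    ultimately show "vnorm e (\<lambda>j. Z t j - Z s j) \<le> G t - G s + \<epsilon>"
      using est[of "\<epsilon> / (V t - V s + 1)"] by linarith
  qed
qed

lemma primitive_exists:
  assumes "0 \<le> s" "s \<le> t" "t \<le> T" "continuous_on {s..t} f" "i < d"
  shows "\<exists>I. rs_primitive V s t f (\<lambda>u. X u i) I"
proof (rule rs_primitive_exists[OF assms(2,4)])
  have sub: "{s..t} \<subseteq> {0..T}" using assms by auto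
  show "continuous_on {s..t} (\<lambda>u. X u i)" "continuous_on {s..t} V"
    using continuous_on_subset[OF _ sub] X_continuous[OF \<open>i < d\<close>] V_continuous by blast+
  fix p q assume pq: "s \<le> p" "p \<le> q" "q \<le> t"
  have "\<bar>X q i - X p i\<bar> \<le> vnorm d (\<lambda>i. X q i - X p i)" using \<open>i < d\<close> by (rule abs_le_vnorm)
  also have "\<dots> \<le> V q - V p" using vnorm_le_V_diff pq assms by simp
  finally show "\<bar>X q i - X p i\<bar> \<le> V q - V p" .
qed

text \<open>The integral \<open>\<integral> A(dX) Y\<close> over \<open>[s, u]\<close>.\<close>

definition cde_integral :: "real \<Rightarrow> (real \<Rightarrow> rvec) \<Rightarrow> real \<Rightarrow> rvec" where
  "cde_integral s Y u = (\<lambda>j. \<Sum>i<d. \<Sum>k<e. A i j k * rs_integral (\<lambda>v. Y v k) (\<lambda>v. X v i) s u)"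

lemma cde_integral_drives:
  assumes st: "0 \<le> s" "s \<le> t" "t \<le> T" and Y: "\<And>k. k < e \<Longrightarrow> continuous_on {s..t} (\<lambda>u. Y u k)"
  shows "drives s t Y (cde_integral s Y)" "cde_integral s Y s j = 0"
proof -
  have mono: "V p \<le> V q" if "s \<le> p" "p \<le> q" "q \<le> t" for p q
    using V_mono[of p q] st that by auto
  have "\<forall>i k. \<exists>I. i < d \<and> k < e \<longrightarrow> rs_primitive V s t (\<lambda>v. Y v k) (\<lambda>v. X v i) I"
    using primitive_exists[OF st] Y by blast
  then obtain I where I: "\<And>i k. \<lbrakk>i < d; k < e\<rbrakk> \<Longrightarrow> rs_primitive V s t (\<lambda>v. Y v k) (\<lambda>v. X v i) (I i k)"
    by metis
  have eq: "cde_integral s Y u j = (\<Sum>i<d. \<Sum>k<e. A i j k * (I i k u - I i k s))"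
    if "s \<le> u" "u \<le> t" for u j
    unfolding cde_integral_def using that mono
    by (intro sum.cong refl arg_cong2[where f = "(*)"] rs_integral_eq[OF I]) auto
  show "cde_integral s Y s j = 0" using eq[of s j] st by simp
  show "drives s t Y (cde_integral s Y)"
    unfolding drives_def
  proof (intro allI impI)
    fix j assume "j < e"
    have "remainder V s t (\<lambda>p x q. \<Sum>i<d. \<Sum>k<e.
        A i j k * (Y x k * (X q i - X p i) - (I i k q - I i k p)))"
      using I unfolding rs_primitive_def
      by (intro remainder_sum mono remainder_cmult) auto
    then show "remainder V s t (\<lambda>p x q. lin_app d e A (\<lambda>i. X q i - X p i) (Y x) j -
        (cde_integral s Y q j - cde_integral s Y p j))"
    proof (rule remainder_bound[of _ _ _ _ 1])
      fix p x q assume pxq: "s \<le> p" "p \<le> x" "x \<le> q" "q \<le> t"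
      have "cde_integral s Y q j - cde_integral s Y p j =
          (\<Sum>i<d. \<Sum>k<e. A i j k * (I i k q - I i k p))"
        using eq[of p j] eq[of q j] pxq by (simp add: sum_subtractf[symmetric] algebra_simps)
      then have "lin_app d e A (\<lambda>i. X q i - X p i) (Y x) j -
          (cde_integral s Y q j - cde_integral s Y p j) = (\<Sum>i<d. \<Sum>k<e.
            A i j k * (Y x k * (X q i - X p i) - (I i k q - I i k p)))"
        by (simp add: lin_app_def sum_distrib_left sum_subtractf right_diff_distrib mult_ac)
      then show "\<bar>lin_app d e A (\<lambda>i. X q i - X p i) (Y x) j -
          (cde_integral s Y q j - cde_integral s Y p j)\<bar> \<le> 1 * \<bar>\<Sum>i<d. \<Sum>k<e.
            A i j k * (Y x k * (X q i - X p i) - (I i k q - I i k p))\<bar>" by simp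
    qed simp
  qed
qed

lemma cde_solution_integral:
  "cde_solution d e A X s t Y \<longleftrightarrow> (\<forall>j<e. continuous_on {s..t} (\<lambda>u. Y u j)) \<and>
     (\<forall>u\<in>{s..t}. \<forall>j<e. Y u j = Y s j + cde_integral s Y u j)"
  by (simp add: cde_solution_def cde_integral_def)

lemma cde_solution_iff_drives:
  assumes st: "0 \<le> s" "s \<le> t" "t \<le> T"
  shows "cde_solution d e A X s t Y \<longleftrightarrow>
    (\<forall>j<e. continuous_on {s..t} (\<lambda>u. Y u j)) \<and> drives s t Y Y"
proof (intro iffI conjI)
  assume sol: "cde_solution d e A X s t Y"
  then show cont: "\<forall>j<e. continuous_on {s..t} (\<lambda>u. Y u j)" by (simp add: cde_solution_def)
  show "drives s t Y Y"
  proof (rule drives_cong)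
    show "drives s t Y (cde_integral s Y)" using cont by (intro cde_integral_drives st) simp
    show "Y u j = Y s j + cde_integral s Y u j" if "s \<le> u" "u \<le> t" "j < e" for u j
      using sol that unfolding cde_solution_integral by (meson atLeastAtMost_iff)
  qed
next
  assume asm: "(\<forall>j<e. continuous_on {s..t} (\<lambda>u. Y u j)) \<and> drives s t Y Y"
  then have cont: "\<And>j. j < e \<Longrightarrow> continuous_on {s..t} (\<lambda>u. Y u j)" by blast
  note Z = cde_integral_drives[OF st, of Y, OF cont]
  have eq: "Y u j = Y s j + cde_integral s Y u j" if "s \<le> u" "u \<le> t" "j < e" for u j
  proof -
    let ?a = "\<lambda>p x q. lin_app d e A (\<lambda>i. X q i - X p i) (Y x) j"
    have "remainder V s t (\<lambda>p x q. (?a p x q - (cde_integral s Y q j - cde_integral s Y p j)) -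
        (?a p x q - (Y q j - Y p j)))"
      using asm Z(1) that(3)
      by (intro remainder_diff[where R = "\<lambda>p x q. ?a p x q - (cde_integral s Y q j - cde_integral s Y p j)"])
        (simp_all add: drives_def)
    then have "remainder V s u (\<lambda>p x q. (Y q j - cde_integral s Y q j) - (Y p j - cde_integral s Y p j))"
      using that by (intro remainder_subinterval[of V s t _ s u]) (simp_all add: algebra_simps)
    then have "Y u j - cde_integral s Y u j = Y s j - cde_integral s Y s j"
      using that(1) by (rule remainder_increment_zero)
    then show ?thesis using Z(2)[of j] by simp
  qed
  show "cde_solution d e A X s t Y"
    unfolding cde_solution_integral by (intro conjI allI impI ballI cont eq) simp_all
qed

text \<open>The difference of two solutions drives itself and vanishes at \<open>s\<close>. Iterating the growth estimate
  from a constant bound yields arbitrary terms of an exponential series as bounds.\<close>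

lemma cde_solution_unique:
  assumes st: "0 \<le> s" "s \<le> t" "t \<le> T"
    and Y: "cde_solution d e A X s t Y" and Y': "cde_solution d e A X s t Y'"
    and init: "\<And>j. j < e \<Longrightarrow> Y s j = Y' s j" and "j < e"
  shows "Y t j = Y' t j"
proof -
  define D where "D u k = Y u k - Y' u k" for u k
  have dr: "drives s t D D"
    using Y Y' drives_diff unfolding D_def cde_solution_iff_drives[OF st] by blast
  have "continuous_on {s..t} (\<lambda>u. vnorm e (D u))"
    unfolding L2_set_def D_def using Y Y' by (intro continuous_intros) (auto simp: cde_solution_def)
  then have "bounded ((\<lambda>u. vnorm e (D u)) ` {s..t})"
    using compact_continuous_image compact_imp_bounded by blast
  then obtain M where "\<forall>u\<in>{s..t}. vnorm e (D u) \<le> M" by (auto simp: bounded_iff)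
  then have M: "vnorm e (D u) \<le> M" if "s \<le> u" "u \<le> t" for u using that by simp
  have M0: "0 \<le> M" using M[of s] st by (meson L2_set_nonneg order_refl order_trans)
  have D0: "vnorm e (\<lambda>j. D u j - D s j) = vnorm e (D u)" for u
    by (intro L2_set_cong) (auto simp: D_def init)
  have "vnorm e (D u) \<le> M * ((r * (V u - V s)) ^ n / fact n)" if "s \<le> u" "u \<le> t" for u n
    using that
  proof (induction n arbitrary: u)
    case 0
    then show ?case using M by simp
  next
    case (Suc n)
    let ?G = "\<lambda>u. M * ((r * (V u - V s)) ^ Suc n / fact (Suc n))"
    have "vnorm e (\<lambda>j. D u j - D s j) \<le> ?G u - ?G s"
    proof (rule drives_growth)
      show "drives s u D D" using dr Suc.prems by (intro drives_subinterval[OF dr]) auto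
      fix p q assume pq: "s \<le> p" "p \<le> q" "q \<le> u"
      have mono: "V s \<le> V p" "V p \<le> V q" using V_mono st pq Suc.prems by auto
      have "r * (V q - V p) * vnorm e (D p) \<le> r * (V q - V p) * (M * ((r * (V p - V s)) ^ n / fact n))"
        using Suc.IH[of p] pq Suc.prems mono r_nonneg by (intro mult_left_mono) auto
      also have "\<dots> = M * ((r * (V p - V s)) ^ n / fact n * (r * ((V q - V s) - (V p - V s))))"
        by simp
      also have "\<dots> \<le> M * ((r * (V q - V s)) ^ Suc n / fact (Suc n) - (r * (V p - V s)) ^ Suc n / fact (Suc n))"
        using M0 r_nonneg mono by (intro mult_left_mono exp_term_increment) auto
      finally show "r * (V q - V p) * vnorm e (D p) \<le> ?G q - ?G p"
        by (simp only: right_diff_distrib)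
    qed (use st Suc.prems in auto)
    then show ?case unfolding D0 by simp
  qed
  then have "vnorm e (D t) \<le> M * 0"
    using st by (intro LIMSEQ_le_const[OF tendsto_mult[OF tendsto_const exp_terms_tendsto]]) auto
  then have "\<bar>D t j\<bar> \<le> 0" using abs_le_vnorm[OF \<open>j < e\<close>, of "D t"] by simp
  then show ?thesis by (simp add: D_def)
qed


section \<open>The signature series\<close>

text \<open>The degree \<open>n\<close> term of the signature expansion of the flow, as a function of the end time \<open>u\<close>.\<close>

definition level :: "nat \<Rightarrow> real \<Rightarrow> rvec \<Rightarrow> real \<Rightarrow> rvec" where
  "level n s y u = tensor_app d e A n y (signature X s u)"

text \<open>Continuity of an iterated integral is what makes the next one exist, so the two facts are proved
  together.\<close>

lemma sig_rev_continuous: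
  assumes "0 \<le> s" "s \<le> T"
  shows "set w \<subseteq> {..<d} \<Longrightarrow> continuous_on {s..T} (sig_rev X s w)"
    and "\<lbrakk>set w \<subseteq> {..<d}; i < d\<rbrakk> \<Longrightarrow> \<exists>I. rs_primitive V s T (sig_rev X s w) (\<lambda>u. X u i) I \<and>
      (\<forall>u\<in>{s..T}. sig_rev X s (i # w) u = I u - I s)"
proof -
  have prim: "\<exists>I. rs_primitive V s T (sig_rev X s w) (\<lambda>u. X u i) I \<and>
      (\<forall>u\<in>{s..T}. sig_rev X s (i # w) u = I u - I s)"
    if cont: "continuous_on {s..T} (sig_rev X s w)" and i: "i < d" for w i
  proof -
    obtain I where I: "rs_primitive V s T (sig_rev X s w) (\<lambda>u. X u i) I"
      using primitive_exists[OF assms order_refl cont i] by blast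
    have "sig_rev X s (i # w) u = I u - I s" if "u \<in> {s..T}" for u
      using rs_integral_eq[OF I, of s u] V_mono[of s u] that assms by simp
    then show ?thesis using I by blast
  qed
  have cont: "continuous_on {s..T} (sig_rev X s w)" if "set w \<subseteq> {..<d}" for w
    using that
  proof (induction w)
    case (Cons i w)
    then have i: "i < d" by simp
    from Cons obtain I where I: "rs_primitive V s T (sig_rev X s w) (\<lambda>u. X u i) I"
      "\<forall>u\<in>{s..T}. sig_rev X s (i # w) u = I u - I s"
      using prim[of w i] by auto
    have sub: "{s..T} \<subseteq> {0..T}" using assms by auto
    have "continuous_on {s..T} I"
      using rs_primitive_continuous[OF I(1)] continuous_on_subset[OF _ sub]
        X_continuous[OF i] V_continuous by blast
    then have "continuous_on {s..T} (\<lambda>u. I u - I s)" by (intro continuous_intros)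
    then show ?case using I(2) by (subst continuous_on_cong[OF refl]) auto
  qed simp
  then show "set w \<subseteq> {..<d} \<Longrightarrow> continuous_on {s..T} (sig_rev X s w)" .
  show "\<lbrakk>set w \<subseteq> {..<d}; i < d\<rbrakk> \<Longrightarrow> \<exists>I. rs_primitive V s T (sig_rev X s w) (\<lambda>u. X u i) I \<and>
      (\<forall>u\<in>{s..T}. sig_rev X s (i # w) u = I u - I s)"
    using prim cont by blast
qed

lemma level_continuous:
  assumes "0 \<le> s" "s \<le> T"
  shows "continuous_on {s..T} (\<lambda>u. level n s y u j)"
  unfolding level_def tensor_app_def signature_def
  by (intro continuous_on_sum continuous_on_mult_right sig_rev_continuous[OF assms])
     (auto simp: words_def)

lemma level_0: "level 0 s y u = y"
proof -
  have "words d 0 = {[]}" by (auto simp: words_def)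
  then show ?thesis by (simp add: level_def tensor_app_def signature_def)
qed

lemma level_Suc:
  assumes s: "0 \<le> s" "s \<le> T"
  shows "drives s T (level n s y) (level (Suc n) s y)" "level (Suc n) s y s j = 0"
proof -
  have mono: "V p \<le> V q" if "s \<le> p" "p \<le> q" "q \<le> T" for p q
    using V_mono[of p q] s that by auto
  let ?f = "\<lambda>w. fold (\<lambda>i. lin_app d e A (basis_vec i)) w y"
  have "\<forall>w i. \<exists>I. w \<in> words d n \<and> i < d \<longrightarrow>
      rs_primitive V s T (\<lambda>u. signature X s u w) (\<lambda>u. X u i) I \<and>
      (\<forall>u\<in>{s..T}. signature X s u (w @ [i]) = I u - I s)"
  proof (intro allI)
    fix w i
    show "\<exists>I. w \<in> words d n \<and> i < d \<longrightarrow>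
      rs_primitive V s T (\<lambda>u. signature X s u w) (\<lambda>u. X u i) I \<and>
      (\<forall>u\<in>{s..T}. signature X s u (w @ [i]) = I u - I s)"
      using sig_rev_continuous(2)[OF s, of "rev w" i] by (auto simp: words_def signature_def)
  qed
  then obtain I where "\<And>w i. \<lbrakk>w \<in> words d n; i < d\<rbrakk> \<Longrightarrow>
      rs_primitive V s T (\<lambda>u. signature X s u w) (\<lambda>u. X u i) (I w i) \<and>
      (\<forall>u\<in>{s..T}. signature X s u (w @ [i]) = I w i u - I w i s)" by metis
  then have I: "\<And>w i. \<lbrakk>w \<in> words d n; i < d\<rbrakk> \<Longrightarrow>
      rs_primitive V s T (\<lambda>u. signature X s u w) (\<lambda>u. X u i) (I w i)"
    and sig: "\<And>w i u. \<lbrakk>w \<in> words d n; i < d; s \<le> u; u \<le> T\<rbrakk> \<Longrightarrow>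
      signature X s u (w @ [i]) = I w i u - I w i s" by auto
  let ?c = "\<lambda>w i j. lin_app d e A (basis_vec i) (?f w) j"
  have lev: "level (Suc n) s y u j = (\<Sum>w\<in>words d n. \<Sum>i<d. ?c w i j * (I w i u - I w i s))"
    if "s \<le> u" "u \<le> T" for u j
    unfolding level_def tensor_app_def sum_words_Suc
    using sig that by (intro sum.cong refl) (simp add: mult.commute)
  show "level (Suc n) s y s j = 0" using lev[of s j] s by simp
  show "drives s T (level n s y) (level (Suc n) s y)"
    unfolding drives_def
  proof (intro allI impI)
    fix j assume "j < e"
    let ?S = "\<lambda>p x q. \<Sum>w\<in>words d n. \<Sum>i<d. ?c w i j * (signature X s x w * (X q i - X p i) - (I w i q - I w i p))"
    have "remainder V s T ?S"
      using I unfolding rs_primitive_def by (intro remainder_sum mono remainder_cmult) auto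
    then show "remainder V s T (\<lambda>p x q. lin_app d e A (\<lambda>i. X q i - X p i) (level n s y x) j -
        (level (Suc n) s y q j - level (Suc n) s y p j))"
    proof (rule remainder_bound[of _ _ _ _ 1])
      fix p x q assume pxq: "s \<le> p" "p \<le> x" "x \<le> q" "q \<le> T"
      have diff: "level (Suc n) s y q j - level (Suc n) s y p j =
          (\<Sum>w\<in>words d n. \<Sum>i<d. ?c w i j * (I w i q - I w i p))"
        using lev[of p j] lev[of q j] pxq by (simp add: sum_subtractf[symmetric] right_diff_distrib)
      have "lin_app d e A (\<lambda>i. X q i - X p i) (level n s y x) j =
          (\<Sum>w\<in>words d n. signature X s x w * lin_app d e A (\<lambda>i. X q i - X p i) (?f w) j)"
        unfolding level_def tensor_app_def by (rule lin_app_sum[OF finite_words])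
      also have "\<dots> = (\<Sum>w\<in>words d n. \<Sum>i<d. ?c w i j * (signature X s x w * (X q i - X p i)))"
        by (subst lin_app_basis_sum) (simp add: sum_distrib_left mult_ac)
      finally have "lin_app d e A (\<lambda>i. X q i - X p i) (level n s y x) j -
          (level (Suc n) s y q j - level (Suc n) s y p j) = ?S p x q"
        unfolding diff by (simp add: right_diff_distrib sum_subtractf)
      then show "\<bar>lin_app d e A (\<lambda>i. X q i - X p i) (level n s y x) j -
          (level (Suc n) s y q j - level (Suc n) s y p j)\<bar> \<le> 1 * \<bar>?S p x q\<bar>" by simp
    qed simp
  qed
qed

lemma level_bound:
  assumes "0 \<le> s" "s \<le> u" "u \<le> T"
  shows "vnorm e (level n s y u) \<le> (r * (V u - V s)) ^ n / fact n * vnorm e y"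
  using assms(2,3)
proof (induction n arbitrary: u)
  case 0
  then show ?case by (simp add: level_0)
next
  case (Suc n)
  have s: "s \<le> T" using Suc.prems by simp
  let ?G = "\<lambda>u. (r * (V u - V s)) ^ Suc n / fact (Suc n) * vnorm e y"
  have "vnorm e (\<lambda>j. level (Suc n) s y u j - level (Suc n) s y s j) \<le> ?G u - ?G s"
  proof (rule drives_growth)
    show "drives s u (level n s y) (level (Suc n) s y)"
      using Suc.prems by (intro drives_subinterval[OF level_Suc(1)[OF assms(1) s]]) auto
    fix p q assume pq: "s \<le> p" "p \<le> q" "q \<le> u"
    have mono: "V s \<le> V p" "V p \<le> V q" using V_mono assms(1) pq Suc.prems by auto
    have "r * (V q - V p) * vnorm e (level n s y p) \<le>
        r * (V q - V p) * ((r * (V p - V s)) ^ n / fact n * vnorm e y)"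
      using Suc.IH[of p] pq Suc.prems mono r_nonneg by (intro mult_left_mono) auto
    also have "\<dots> = (r * (V p - V s)) ^ n / fact n * (r * ((V q - V s) - (V p - V s))) * vnorm e y"
      by simp
    also have "\<dots> \<le> ((r * (V q - V s)) ^ Suc n / fact (Suc n) -
        (r * (V p - V s)) ^ Suc n / fact (Suc n)) * vnorm e y"
      using r_nonneg mono by (intro mult_right_mono exp_term_increment) auto
    finally show "r * (V q - V p) * vnorm e (level n s y p) \<le> ?G q - ?G p"
      by (simp only: left_diff_distrib)
  qed (use assms(1) Suc.prems in auto)
  then show ?case by (simp add: level_Suc(2)[OF assms(1) s])
qed

lemma euler_step_eq: "euler_step d e A N X s u y = (\<lambda>j. \<Sum>n\<le>N. level n s y u j)"
  by (simp add: euler_step_def level_def)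

lemma euler_step_diff:
  "euler_step d e A N X s u (\<lambda>k. y k - z k) j =
    euler_step d e A N X s u y j - euler_step d e A N X s u z j"
  by (simp add: euler_step_def tensor_app_diff sum_subtractf)

lemma V_diff_nonneg: "\<lbrakk>0 \<le> s; s \<le> u; u \<le> T\<rbrakk> \<Longrightarrow> 0 \<le> r * (V u - V s)"
  using V_mono[of s u] r_nonneg by simp

lemma euler_step_bound:
  assumes "0 \<le> s" "s \<le> u" "u \<le> T"
  shows "vnorm e (euler_step d e A N X s u y) \<le> exp (r * (V u - V s)) * vnorm e y"
proof -
  have "vnorm e (euler_step d e A N X s u y) \<le> (\<Sum>n\<le>N. vnorm e (level n s y u))"
    unfolding euler_step_eq by (rule vnorm_sum_le) simp
  also have "\<dots> \<le> (\<Sum>n\<le>N. (r * (V u - V s)) ^ n / fact n * vnorm e y)"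
    by (intro sum_mono level_bound assms)
  also have "\<dots> \<le> exp (r * (V u - V s)) * vnorm e y"
    unfolding sum_distrib_right[symmetric]
    using V_diff_nonneg[OF assms] by (intro mult_right_mono exp_partial_sum_le) auto
  finally show ?thesis .
qed

text \<open>The series of all signature levels, which will be identified with the flow.\<close>

definition series :: "real \<Rightarrow> rvec \<Rightarrow> real \<Rightarrow> rvec" where
  "series s y u = (\<lambda>j. \<Sum>n. level n s y u j)"

lemma euler_step_tendsto:
  assumes "0 \<le> s" "s \<le> u" "u \<le> T" "j < e"
  shows "(\<lambda>N. euler_step d e A N X s u y j) \<longlonglongrightarrow> series s y u j"
proof -
  have "summable (\<lambda>n. level n s y u j)"
  proof (rule summable_comparison_test')
    show "summable (\<lambda>n. (r * (V u - V s)) ^ n / fact n * vnorm e y)"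
      by (intro summable_mult2 exp_terms_summable)
    show "norm (level n s y u j) \<le> (r * (V u - V s)) ^ n / fact n * vnorm e y" if "n \<ge> 0" for n
      using abs_le_vnorm[OF assms(4), of "level n s y u"] level_bound[OF assms(1-3), of n y] by simp
  qed
  then show ?thesis unfolding euler_step_eq series_def by (rule summable_LIMSEQ')
qed

lemma series_bound:
  assumes "0 \<le> s" "s \<le> u" "u \<le> T"
  shows "vnorm e (series s y u) \<le> exp (r * (V u - V s)) * vnorm e y"
  by (rule LIMSEQ_le_const2[OF tendsto_vnorm[OF euler_step_tendsto[OF assms]]])
     (use euler_step_bound[OF assms] in auto)

lemma series_remainder:
  assumes "0 \<le> s" "s \<le> u" "u \<le> T"
  shows "vnorm e (\<lambda>j. series s y u j - euler_step d e A N X s u y j) \<le>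
    (r * (V u - V s)) ^ Suc N / fact (Suc N) * exp (r * (V u - V s)) * vnorm e y"
    (is "_ \<le> ?K")
proof (rule LIMSEQ_le_const2)
  show "(\<lambda>M. vnorm e (\<lambda>j. euler_step d e A M X s u y j - euler_step d e A N X s u y j))
      \<longlonglongrightarrow> vnorm e (\<lambda>j. series s y u j - euler_step d e A N X s u y j)"
    by (intro tendsto_vnorm tendsto_intros euler_step_tendsto assms)
  have "vnorm e (\<lambda>j. euler_step d e A M X s u y j - euler_step d e A N X s u y j) \<le> ?K"
    if "M \<ge> N" for M
  proof -
    have "{..M} = {..N} \<union> {Suc N..M}" using that by auto
    then have "(\<lambda>j. euler_step d e A M X s u y j - euler_step d e A N X s u y j) =
        (\<lambda>j. \<Sum>n=Suc N..M. level n s y u j)"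
      unfolding euler_step_eq by (simp add: sum.union_disjoint)
    then have "vnorm e (\<lambda>j. euler_step d e A M X s u y j - euler_step d e A N X s u y j) \<le>
        (\<Sum>n=Suc N..M. vnorm e (level n s y u))"
      using vnorm_sum_le[of "{Suc N..M}" "\<lambda>n. level n s y u" e] by simp
    also have "\<dots> \<le> (\<Sum>n=Suc N..M. (r * (V u - V s)) ^ n / fact n * vnorm e y)"
      by (intro sum_mono level_bound assms)
    also have "\<dots> \<le> ?K"
      unfolding sum_distrib_right[symmetric]
      using V_diff_nonneg[OF assms] by (intro mult_right_mono exp_tail_le) auto
    finally show ?thesis .
  qed
  then show "\<exists>N'. \<forall>M\<ge>N'. vnorm e (\<lambda>j. euler_step d e A M X s u y j - euler_step d e A N X s u y j) \<le> ?K"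
    by blast
qed

lemma series_remainder_uniform:
  assumes "0 \<le> s" "s \<le> u" "u \<le> T"
  shows "vnorm e (\<lambda>j. series s y u j - euler_step d e A N X s u y j) \<le>
    (r * V T) ^ Suc N / fact (Suc N) * exp (r * V T) * vnorm e y"
proof -
  have le: "r * (V u - V s) \<le> r * V T"
    using V_mono[of u T] V_nonneg[of s] assms r_nonneg by (intro mult_left_mono) auto
  have nn: "0 \<le> r * (V u - V s)" by (rule V_diff_nonneg[OF assms])
  have "vnorm e (\<lambda>j. series s y u j - euler_step d e A N X s u y j) \<le>
      (r * (V u - V s)) ^ Suc N / fact (Suc N) * exp (r * (V u - V s)) * vnorm e y"
    by (rule series_remainder[OF assms])
  also have "\<dots> \<le> (r * V T) ^ Suc N / fact (Suc N) * exp (r * V T) * vnorm e y"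
  proof -
    have "x ^ Suc N / fact (Suc N) * exp x \<le> z ^ Suc N / fact (Suc N) * exp z"
      if "0 \<le> x" "x \<le> z" for x z :: real
      using that by (intro mult_mono divide_right_mono power_mono) auto
    from this[OF nn le] show ?thesis by (rule mult_right_mono) simp
  qed
  finally show ?thesis .
qed

lemma uniform_remainder_tendsto:
  "(\<lambda>N. (r * V T) ^ Suc N / fact (Suc N) * exp (r * V T) * vnorm e y) \<longlonglongrightarrow> 0"
  using tendsto_mult_left_zero[OF tendsto_mult_left_zero[OF LIMSEQ_Suc[OF exp_terms_tendsto]]] .

lemma series_continuous:
  assumes s: "0 \<le> s" "s \<le> T" and "j < e"
  shows "continuous_on {s..T} (\<lambda>u. series s y u j)"
proof (rule uniform_limit_theorem)
  show "\<forall>\<^sub>F N in sequentially. continuous_on {s..T} (\<lambda>u. euler_step d e A N X s u y j)"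
    unfolding euler_step_eq using level_continuous[OF s] by (intro always_eventually allI continuous_on_sum)
  show "uniform_limit {s..T} (\<lambda>N u. euler_step d e A N X s u y j) (\<lambda>u. series s y u j) sequentially"
  proof (rule uniform_limitI)
    fix \<epsilon> :: real assume "\<epsilon> > 0"
    from order_tendstoD(2)[OF uniform_remainder_tendsto this, of y]
    show "\<forall>\<^sub>F N in sequentially. \<forall>u\<in>{s..T}. dist (euler_step d e A N X s u y j) (series s y u j) < \<epsilon>"
    proof eventually_elim
      case (elim N)
      show ?case
      proof
        fix u assume u: "u \<in> {s..T}"
        have "dist (euler_step d e A N X s u y j) (series s y u j) =
            \<bar>series s y u j - euler_step d e A N X s u y j\<bar>" by (simp add: dist_real_def)
        also have "\<dots> \<le> vnorm e (\<lambda>j. series s y u j - euler_step d e A N X s u y j)"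
          by (rule abs_le_vnorm[OF \<open>j < e\<close>])
        also have "\<dots> < \<epsilon>" using series_remainder_uniform[of s u y N] s u elim by simp
        finally show "dist (euler_step d e A N X s u y j) (series s y u j) < \<epsilon>" .
      qed
    qed
  qed
qed simp

lemma series_start: "0 \<le> s \<Longrightarrow> s \<le> T \<Longrightarrow> series s y s j = y j"
proof -
  assume s: "0 \<le> s" "s \<le> T"
  have "(\<Sum>n. level n s y s j) = (\<Sum>n\<in>{0}. level n s y s j)"
  proof (rule suminf_finite)
    show "level n s y s j = 0" if "n \<notin> {0}" for n
      using that level_Suc(2)[OF s, of "n - 1"] by simp
  qed simp
  then show ?thesis by (simp add: series_def level_0)
qed

lemma drives_euler_step:
  assumes s: "0 \<le> s" "s \<le> T"
  shows "drives s T (\<lambda>u. euler_step d e A N X s u y) (\<lambda>u. euler_step d e A (Suc N) X s u y)"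
  unfolding drives_def
proof (intro allI impI)
  fix j assume "j < e"
  have mono: "V p \<le> V q" if "s \<le> p" "p \<le> q" "q \<le> T" for p q
    using V_mono[of p q] s that by auto
  have "remainder V s T (\<lambda>p x q. \<Sum>n\<le>N. lin_app d e A (\<lambda>i. X q i - X p i) (level n s y x) j -
      (level (Suc n) s y q j - level (Suc n) s y p j))"
    using level_Suc(1)[OF s] \<open>j < e\<close> unfolding drives_def by (intro remainder_sum mono) auto
  moreover have "lin_app d e A x (\<lambda>k. \<Sum>n\<le>N. level n s y u k) j =
      (\<Sum>n\<le>N. lin_app d e A x (level n s y u) j)" for x u
    using lin_app_sum[of "{..N}" d e A x "\<lambda>_. 1" "\<lambda>n. level n s y u" j] by simp
  ultimately show "remainder V s T (\<lambda>p x q. lin_app d e A (\<lambda>i. X q i - X p i) (euler_step d e A N X s x y) j -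
      (euler_step d e A (Suc N) X s q y j - euler_step d e A (Suc N) X s p y j))"
    unfolding euler_step_eq by (simp only: sum.atMost_Suc_shift level_0 sum_subtractf add_diff_cancel_left)
qed

text \<open>Partial sums drive the next partial sums. In the limit, the growth estimate for the difference
  between the series and a partial sum shows that the series differs from its own integral only by
  its initial value.\<close>

lemma series_solution:
  assumes st: "0 \<le> s" "s \<le> t" "t \<le> T"
  shows "cde_solution d e A X s t (series s y)"
proof -
  let ?S = "series s y" and ?E = "\<lambda>N u. euler_step d e A N X s u y"
  let ?Z = "cde_integral s ?S"
  let ?K = "\<lambda>N. (r * V T) ^ Suc N / fact (Suc N) * exp (r * V T) * vnorm e y"
  have s: "s \<le> T" using st by simp
  have cont: "continuous_on {s..t} (\<lambda>u. ?S u j)" if "j < e" for j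
    by (rule continuous_on_subset[OF series_continuous[OF st(1) s that]]) (use st in auto)
  note Z = cde_integral_drives[OF st, of ?S, OF cont]
  have eq: "?S u j = ?S s j + ?Z u j" if u: "s \<le> u" "u \<le> t" and j: "j < e" for u j
  proof -
    have le: "vnorm e (\<lambda>j. (?Z u j - ?E (Suc N) u j) - (?Z s j - ?E (Suc N) s j)) \<le>
        r * ?K N * V u - r * ?K N * V s" for N
    proof (rule drives_growth[of s u "\<lambda>u k. ?S u k - ?E N u k"])
      have "drives s t (?E N) (?E (Suc N))"
        using st by (intro drives_subinterval[OF drives_euler_step[OF st(1) s]]) auto
      from drives_diff[OF Z(1) this]
      show "drives s u (\<lambda>u k. ?S u k - ?E N u k) (\<lambda>u j. ?Z u j - ?E (Suc N) u j)"
        by (rule drives_subinterval) (use u in auto)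
      fix p q assume pq: "s \<le> p" "p \<le> q" "q \<le> u"
      have "r * (V q - V p) * vnorm e (\<lambda>k. ?S p k - ?E N p k) \<le> r * (V q - V p) * ?K N"
        using pq u st V_diff_nonneg[of p q] by (intro mult_left_mono series_remainder_uniform) auto
      moreover have "r * (b - a) * k = r * k * b - r * k * a" for a b k :: real
        by (simp add: algebra_simps)
      ultimately show "r * (V q - V p) * vnorm e (\<lambda>k. ?S p k - ?E N p k) \<le> r * ?K N * V q - r * ?K N * V p"
        by (simp only:)
    qed (use st u in auto)
    have "vnorm e (\<lambda>j. (?Z u j - ?S u j) - (?Z s j - ?S s j)) \<le> r * 0 * V u - r * 0 * V s"
    proof (rule LIMSEQ_le)
      show "(\<lambda>N. vnorm e (\<lambda>j. (?Z u j - ?E (Suc N) u j) - (?Z s j - ?E (Suc N) s j))) \<longlonglongrightarrow>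
          vnorm e (\<lambda>j. (?Z u j - ?S u j) - (?Z s j - ?S s j))"
        using u st by (intro tendsto_vnorm tendsto_intros LIMSEQ_Suc[OF euler_step_tendsto]) auto
      show "(\<lambda>N. r * ?K N * V u - r * ?K N * V s) \<longlonglongrightarrow> r * 0 * V u - r * 0 * V s"
        by (intro tendsto_intros uniform_remainder_tendsto)
    qed (use le in blast)
    then have "\<bar>(?Z u j - ?S u j) - (?Z s j - ?S s j)\<bar> \<le> 0"
      using abs_le_vnorm[OF j, of "\<lambda>j. (?Z u j - ?S u j) - (?Z s j - ?S s j)"] by simp
    then show ?thesis using Z(2)[of j] by simp
  qed
  show ?thesis unfolding cde_solution_integral by (intro conjI allI impI ballI cont eq) simp_all
qed

lemma flow_eq:
  assumes st: "0 \<le> s" "s \<le> t" "t \<le> T" and Y: "cde_solution d e A X s t Y"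
    and init: "\<And>j. j < e \<Longrightarrow> Y s j = y j" and "j < e"
  shows "flow d e A X s t y j = Y t j"
proof -
  have "flow d e A X s t y = (\<lambda>j. if j < e then Y t j else 0)"
    unfolding flow_def
  proof (rule the_equality)
    fix z assume z: "(\<forall>j\<ge>e. z j = 0) \<and> (\<exists>Y. cde_solution d e A X s t Y \<and>
      (\<forall>j<e. Y s j = y j) \<and> (\<forall>j<e. Y t j = z j))"
    then obtain Y' where Y': "cde_solution d e A X s t Y'" "\<forall>j<e. Y' s j = y j" "\<forall>j<e. Y' t j = z j"
      by blast
    show "z = (\<lambda>j. if j < e then Y t j else 0)"
    proof
      fix j
      show "z j = (if j < e then Y t j else 0)"
        using z Y' init cde_solution_unique[OF st Y Y'(1), of j] by auto
    qed
  qed (use Y init in auto)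
  then show ?thesis using \<open>j < e\<close> by simp
qed

lemma flow_eq_series:
  assumes st: "0 \<le> s" "s \<le> t" "t \<le> T" and "j < e"
  shows "flow d e A X s t y j = series s y t j"
  by (rule flow_eq[OF st series_solution[OF st]]) (use assms series_start in auto)

lemma flow_semigroup:
  assumes st: "0 \<le> s" "s \<le> t" "t \<le> T" and "j < e"
  shows "flow d e A X 0 t y j = flow d e A X s t (flow d e A X 0 s y) j"
proof -
  have "0 \<le> t" using st by simp
  have sol: "cde_solution d e A X 0 t (series 0 y)"
    by (rule series_solution) (use st in auto)
  then have "cde_solution d e A X s t (series 0 y)"
    unfolding cde_solution_iff_drives[OF st] cde_solution_iff_drives[OF order_refl \<open>0 \<le> t\<close> st(3)]
    using st by (auto intro: drives_subinterval continuous_on_subset)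
  then have "flow d e A X s t (flow d e A X 0 s y) j = series 0 y t j"
    using flow_eq_series[of 0 s _ y] st \<open>j < e\<close> by (intro flow_eq[OF st]) auto
  then show ?thesis using flow_eq_series[of 0 t j y] st \<open>j < e\<close> by simp
qed

lemma flow_bound:
  assumes st: "0 \<le> s" "s \<le> t" "t \<le> T"
  shows "vnorm e (flow d e A X s t y) \<le> exp (r * (V t - V s)) * vnorm e y"
proof -
  have "vnorm e (flow d e A X s t y) = vnorm e (series s y t)"
    by (intro L2_set_cong) (auto simp: flow_eq_series[OF st])
  then show ?thesis using series_bound[OF st] by simp
qed

lemma flow_local_error:
  assumes st: "0 \<le> s" "s \<le> t" "t \<le> T"
  shows "vnorm e (\<lambda>j. flow d e A X s t y j - euler_step d e A N X s t y j) \<le>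
    (r * (V t - V s)) ^ Suc N / fact (Suc N) * exp (r * (V t - V s)) * vnorm e y"
proof -
  have "vnorm e (\<lambda>j. flow d e A X s t y j - euler_step d e A N X s t y j) =
      vnorm e (\<lambda>j. series s y t j - euler_step d e A N X s t y j)"
    by (intro L2_set_cong) (auto simp: flow_eq_series[OF st])
  then show ?thesis using series_remainder[OF st] by simp
qed

end


section \<open>Partitions and the global error\<close>

lemma partition_mono:
  assumes "is_partition T m \<pi>" "i \<le> j" "j \<le> m"
  shows "\<pi> i \<le> \<pi> j"
  using assms(2,3)
proof (induction j)
  case (Suc j)
  show ?case
  proof (cases "i = Suc j")
    case False
    then have "\<pi> i \<le> \<pi> j" using Suc by simp
    also have "\<pi> j < \<pi> (Suc j)" using assms(1) Suc.prems by (simp add: is_partition_def)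
    finally show ?thesis by simp
  qed simp
qed simp

lemma partition_bounds:
  assumes "is_partition T m \<pi>" "k \<le> m"
  shows "0 \<le> \<pi> k" "\<pi> k \<le> T"
  using partition_mono[OF assms(1), of 0 k] partition_mono[OF assms(1), of k m] assms
  by (auto simp: is_partition_def)

lemma power_mean:
  fixes a :: "nat \<Rightarrow> real"
  assumes "0 < m" "\<And>k. k < m \<Longrightarrow> 0 \<le> a k"
  shows "real m * ((\<Sum>k<m. a k) / real m) ^ Suc N \<le> (\<Sum>k<m. a k ^ Suc N)"
proof -
  define c where "c = (\<Sum>k<m. a k) / real m"
  have c: "0 \<le> c" unfolding c_def using assms(2) by (intro divide_nonneg_nonneg sum_nonneg) auto
  have "(\<Sum>k<m. c ^ Suc N + real (Suc N) * c ^ N * (a k - c)) \<le> (\<Sum>k<m. a k ^ Suc N)"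
  proof (rule sum_mono)
    fix k assume "k \<in> {..<m}"
    then show "c ^ Suc N + real (Suc N) * c ^ N * (a k - c) \<le> a k ^ Suc N"
      using power_increment_lower[of c "a k" N] c assms(2) by simp
  qed
  moreover have "(\<Sum>k<m. real (Suc N) * c ^ N * (a k - c)) = real (Suc N) * c ^ N * (\<Sum>k<m. a k - c)"
    by (rule sum_distrib_left[symmetric])
  moreover have "(\<Sum>k<m. a k - c) = 0" using assms(1) by (simp add: c_def sum_subtractf)
  ultimately have "real m * c ^ Suc N \<le> (\<Sum>k<m. a k ^ Suc N)"
    by (simp only: sum.distrib sum_constant card_lessThan mult_zero_right add_0_right)
  then show ?thesis by (simp only: c_def)
qed

context bv_path begin

lemma sum_var1_partition:
  assumes "is_partition T m \<pi>" "k \<le> m"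
  shows "(\<Sum>l<k. var1 d X (\<pi> l) (\<pi> (Suc l))) = V (\<pi> k)"
proof -
  have "(\<Sum>l<k. var1 d X (\<pi> l) (\<pi> (Suc l))) = (\<Sum>l<k. V (\<pi> (Suc l)) - V (\<pi> l))"
    using assms partition_bounds[OF assms(1)] partition_mono[OF assms(1)]
    by (intro sum.cong refl var1_eq_V_diff) auto
  also have "\<dots> = V (\<pi> k) - V (\<pi> 0)" by (rule sum_lessThan_telescope)
  finally show ?thesis using assms(1) V_0 by (simp add: is_partition_def)
qed

text \<open>Equal length splits exist by the intermediate value theorem applied to the arc length. If
  the path is constant, every partition will do.\<close>

lemma equal_length_split_exists:
  assumes "0 < m"
  shows "\<exists>\<sigma>. equal_length_split d X T m \<sigma>"
proof (cases "V T = 0")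
  case True
  define \<sigma> where "\<sigma> k = real k * T / real m" for k
  have \<sigma>: "is_partition T m \<sigma>"
    using assms T by (auto simp: is_partition_def \<sigma>_def divide_strict_right_mono)
  have "V u = 0" if "0 \<le> u" "u \<le> T" for u
    using V_mono[of u T] V_nonneg[of u] that True by simp
  moreover have "V T = var1 d X 0 T" by (simp add: V_def)
  ultimately have "equal_length_split d X T m \<sigma>"
    using \<sigma> partition_bounds[OF \<sigma>] partition_mono[OF \<sigma>] True
    by (simp add: equal_length_split_def var1_eq_V_diff)
  then show ?thesis by blast
next
  case False
  then have L: "0 < V T" using V_nonneg[of T] T by simp
  have "\<exists>u. k \<le> m \<longrightarrow> 0 \<le> u \<and> u \<le> T \<and> V u = real k * V T / real m \<and>
      (k = 0 \<longrightarrow> u = 0) \<and> (k = m \<longrightarrow> u = T)" for k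
  proof -
    consider "k = 0" | "k = m" | "0 < k" "k < m" | "m < k" by linarith
    then show ?thesis
    proof cases
      case 1
      then show ?thesis using assms T V_0 by (intro exI[of _ 0]) auto
    next
      case 2
      then show ?thesis using assms T by (intro exI[of _ T]) auto
    next
      case 3
      have "real k * V T \<le> real m * V T" using 3 L by (intro mult_right_mono) auto
      then have "real k * V T / real m \<le> V T" using assms by (simp add: divide_le_eq mult.commute)
      then obtain u where "0 \<le> u" "u \<le> T" "V u = real k * V T / real m"
        using IVT'[of V 0 "real k * V T / real m" T] V_continuous V_0 L T by auto
      then show ?thesis using 3 by auto
    qed auto
  qed
  then obtain \<sigma> where \<sigma>: "\<And>k. k \<le> m \<Longrightarrow> 0 \<le> \<sigma> k \<and> \<sigma> k \<le> T \<and> V (\<sigma> k) = real k * V T / real m \<and>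
      (k = 0 \<longrightarrow> \<sigma> k = 0) \<and> (k = m \<longrightarrow> \<sigma> k = T)" by metis
  have diff: "V (\<sigma> (Suc k)) - V (\<sigma> k) = V T / real m" if "k < m" for k
    using \<sigma>[of k] \<sigma>[of "Suc k"] that by (simp add: diff_divide_distrib[symmetric] algebra_simps)
  have lt: "\<sigma> k < \<sigma> (Suc k)" if "k < m" for k
  proof (rule ccontr)
    assume "\<not> \<sigma> k < \<sigma> (Suc k)"
    then have "V (\<sigma> (Suc k)) \<le> V (\<sigma> k)" using \<sigma>[of k] \<sigma>[of "Suc k"] that by (intro V_mono) auto
    moreover have "0 < V T / real m" using L assms by simp
    ultimately show False using diff[OF that] by simp
  qed
  have part: "is_partition T m \<sigma>" using \<sigma>[of 0] \<sigma>[of m] lt by (simp add: is_partition_def)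
  have "var1 d X (\<sigma> k) (\<sigma> (Suc k)) = var1 d X 0 T / real m" if "k < m" for k
    using diff[OF that] \<sigma>[of k] \<sigma>[of "Suc k"] lt[OF that] that var1_eq_V_diff[of "\<sigma> k" "\<sigma> (Suc k)"]
    by (simp add: V_def)
  then show ?thesis using part by (auto simp: equal_length_split_def)
qed

lemma partition_bound_equal_split:
  assumes "0 < m" "equal_length_split d X T m \<pi>"
  shows "partition_bound r d e X T y N m \<pi> = split_bound r (var1 d X 0 T) e y N m"
proof -
  let ?L = "var1 d X 0 T"
  have "(\<Sum>k<m. var1 d X (\<pi> k) (\<pi> (Suc k)) ^ (N + 1)) = real m * (?L / real m) ^ (N + 1)"
    using assms(2) by (simp add: equal_length_split_def)
  also have "\<dots> = ?L ^ (N + 1) / real m ^ N" using assms(1) by (simp add: power_divide)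
  finally show ?thesis
    by (simp add: partition_bound_def split_bound_def power_mult_distrib del: fact_Suc)
qed

lemma split_bound_le_partition_bound:
  assumes "0 < m" "0 \<le> r" "equal_length_split d X T m \<pi>" "is_partition T m \<sigma>"
  shows "partition_bound r d e X T y N m \<pi> \<le> partition_bound r d e X T y N m \<sigma>"
proof -
  have T': "\<sigma> m = T" using assms(4) by (simp add: is_partition_def)
  have "(\<Sum>k<m. var1 d X (\<pi> k) (\<pi> (Suc k)) ^ Suc N) = real m * (V T / real m) ^ Suc N"
    using assms(3) by (simp add: equal_length_split_def V_def)
  also have "\<dots> \<le> (\<Sum>k<m. var1 d X (\<sigma> k) (\<sigma> (Suc k)) ^ Suc N)"
    using power_mean[OF assms(1), of "\<lambda>k. var1 d X (\<sigma> k) (\<sigma> (Suc k))" N]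
      sum_var1_partition[OF assms(4) order_refl] partition_bounds[OF assms(4)]
      partition_mono[OF assms(4)] by (simp add: T' var1_nonneg)
  finally show ?thesis
    unfolding partition_bound_def using assms(2) by (intro mult_left_mono) auto
qed

end

context linear_cde begin

text \<open>One step: with \<open>F\<close> the flow and \<open>E\<close> the scheme up to \<open>\<pi> k\<close>, the new error is the local error at
  \<open>F\<close> plus the Euler step applied to \<open>F - E\<close>.\<close>

lemma euler_scheme_error:
  assumes P: "is_partition T m \<pi>" and "k \<le> m"
  shows "vnorm e (\<lambda>j. flow d e A X 0 (\<pi> k) y j - euler_scheme d e A N X \<pi> k y j) \<le>
    r ^ Suc N / fact (Suc N) * exp (r * V (\<pi> k)) * vnorm e y *
      (\<Sum>l<k. var1 d X (\<pi> l) (\<pi> (Suc l)) ^ Suc N)"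
  using assms(2)
proof (induction k)
  case 0
  have "\<pi> 0 = 0" using P by (simp add: is_partition_def)
  then show ?case using T by (simp add: L2_set_def flow_eq_series series_start)
next
  case (Suc k)
  let ?s = "\<pi> k" and ?t = "\<pi> (Suc k)"
  let ?F = "flow d e A X 0 ?s y" and ?E = "euler_scheme d e A N X \<pi> k y"
  let ?\<Phi> = "flow d e A X ?s ?t" and ?S = "euler_step d e A N X ?s ?t"
  let ?\<Delta> = "V ?t - V ?s"
  let ?C = "r ^ Suc N / fact (Suc N)"
  let ?\<Sigma> = "\<Sum>l<k. var1 d X (\<pi> l) (\<pi> (Suc l)) ^ Suc N"
  have st: "0 \<le> ?s" "?s \<le> ?t" "?t \<le> T" "?s \<le> T"
    using partition_bounds[OF P] partition_mono[OF P] Suc.prems by auto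
  have "vnorm e (\<lambda>j. flow d e A X 0 ?t y j - euler_scheme d e A N X \<pi> (Suc k) y j) =
      vnorm e (\<lambda>j. (?\<Phi> ?F j - ?S ?F j) + ?S (\<lambda>j. ?F j - ?E j) j)"
    by (intro L2_set_cong refl)
       (simp add: flow_semigroup[OF st(1-3)] euler_step_diff)
  also have "\<dots> \<le> vnorm e (\<lambda>j. ?\<Phi> ?F j - ?S ?F j) + vnorm e (?S (\<lambda>j. ?F j - ?E j))"
    by (rule vnorm_triangle)
  also have "\<dots> \<le> (r * ?\<Delta>) ^ Suc N / fact (Suc N) * exp (r * ?\<Delta>) * vnorm e ?F +
      exp (r * ?\<Delta>) * vnorm e (\<lambda>j. ?F j - ?E j)"
    by (intro add_mono flow_local_error euler_step_bound st)
  also have "\<dots> \<le> (r * ?\<Delta>) ^ Suc N / fact (Suc N) * exp (r * ?\<Delta>) * (exp (r * (V ?s - V 0)) * vnorm e y) +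
      exp (r * ?\<Delta>) * (?C * exp (r * V ?s) * vnorm e y * ?\<Sigma>)"
    using Suc st V_diff_nonneg[OF st(1-3)]
    by (intro add_mono mult_left_mono flow_bound Suc.IH) auto
  also have "\<dots> = ?C * (exp (r * ?\<Delta>) * exp (r * V ?s)) * vnorm e y * (?\<Sigma> + ?\<Delta> ^ Suc N)"
  proof -
    have "c * D * x * (z * w) + x * (c * z * w * S) = c * (x * z) * w * (S + D)"
      for c D x z w S :: real by (simp add: algebra_simps)
    moreover have "(r * ?\<Delta>) ^ Suc N / fact (Suc N) = ?C * ?\<Delta> ^ Suc N"
      by (simp only: power_mult_distrib times_divide_eq_left)
    ultimately show ?thesis by (simp only: V_0 diff_zero)
  qed
  also have "exp (r * ?\<Delta>) * exp (r * V ?s) = exp (r * V ?t)"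
    by (simp add: exp_add[symmetric] algebra_simps)
  also have "?\<Delta> = var1 d X ?s ?t" by (rule var1_eq_V_diff[OF st(1-3), symmetric])
  finally show ?case by (simp del: power_Suc fact_Suc)
qed

lemma euler_error_le:
  assumes "is_partition T m \<pi>"
  shows "euler_error d e A X T y N m \<pi> \<le> partition_bound r d e X T y N m \<pi>"
proof -
  have "\<pi> m = T" using assms by (simp add: is_partition_def)
  then show ?thesis
    using euler_scheme_error[OF assms order_refl, of y N]
    by (simp add: euler_error_def partition_bound_def V_def del: power_Suc fact_Suc)
qed

end


section \<open>Taylor polynomials of the exponential\<close>

text \<open>The Taylor polynomial of degree \<open>N\<close> of the exponential function at \<open>0\<close>.\<close>

definition exp_poly :: "nat \<Rightarrow> real \<Rightarrow> real" where
  "exp_poly N x = (\<Sum>n\<le>N. x ^ n / fact n)"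

lemma exp_poly_tendsto: "(\<lambda>N. exp_poly N x) \<longlonglongrightarrow> exp x"
  using summable_LIMSEQ'[OF exp_terms_summable, of x] by (simp add: exp_poly_def exp_terms_sum)

lemma exp_poly_le_exp: "0 \<le> x \<Longrightarrow> exp_poly N x \<le> exp x"
  unfolding exp_poly_def by (rule exp_partial_sum_le) auto

lemma exp_poly_ge: "0 \<le> x \<Longrightarrow> 1 \<le> N \<Longrightarrow> 1 + x \<le> exp_poly N x"
proof -
  assume "0 \<le> x" "1 \<le> N"
  then have "(\<Sum>n\<in>{0, 1}. x ^ n / fact n) \<le> exp_poly N x"
    unfolding exp_poly_def by (intro sum_mono2) auto
  then show ?thesis by simp
qed

lemma exp_poly_nonneg: "0 \<le> x \<Longrightarrow> 0 \<le> exp_poly N x"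
  unfolding exp_poly_def by (intro sum_nonneg) auto

lemma exp_minus_exp_poly_le:
  assumes "0 \<le> x"
  shows "exp x - exp_poly N x \<le> x ^ Suc N / fact (Suc N) * exp x"
proof (rule LIMSEQ_le_const2)
  show "(\<lambda>M. exp_poly M x - exp_poly N x) \<longlonglongrightarrow> exp x - exp_poly N x"
    by (intro tendsto_intros exp_poly_tendsto)
  have "exp_poly M x - exp_poly N x \<le> x ^ Suc N / fact (Suc N) * exp x" if "N \<le> M" for M
  proof -
    have "{..M} = {..N} \<union> {Suc N..M}" using that by auto
    then have "exp_poly M x = exp_poly N x + (\<Sum>n=Suc N..M. x ^ n / fact n)"
      unfolding exp_poly_def by (simp add: sum.union_disjoint)
    then show ?thesis using exp_tail_le[OF assms, of N M] by simp
  qed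
  then show "\<exists>M. \<forall>M'\<ge>M. exp_poly M' x - exp_poly N x \<le> x ^ Suc N / fact (Suc N) * exp x" by blast
qed

lemma exp_minus_exp_poly_bounds:
  assumes "0 \<le> x"
  shows "x ^ Suc N / fact (Suc N) \<le> exp x - exp_poly N x"
    and "exp x - exp_poly N x \<le> x ^ Suc N / fact (Suc N) * (1 + x * exp x / real (N + 2))"
proof -
  \<comment> \<open>the factor \<open>1 / (N + 2)\<close> comes from estimating the remainder of degree \<open>N + 1\<close> instead\<close>
  have step: "exp_poly (Suc N) x = exp_poly N x + x ^ Suc N / fact (Suc N)"
    by (simp add: exp_poly_def)
  show "x ^ Suc N / fact (Suc N) \<le> exp x - exp_poly N x"
    using exp_poly_le_exp[OF assms, of "Suc N"] step by simp
  have "exp x - exp_poly (Suc N) x \<le> x ^ Suc (Suc N) / fact (Suc (Suc N)) * exp x"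
    by (rule exp_minus_exp_poly_le[OF assms])
  also have "\<dots> = x ^ Suc N / fact (Suc N) * (x * exp x / real (N + 2))"
    by (subst fact_Suc) (simp add: field_simps del: fact_Suc)
  finally show "exp x - exp_poly N x \<le> x ^ Suc N / fact (Suc N) * (1 + x * exp x / real (N + 2))"
    using step by (simp add: distrib_left)
qed

text \<open>With \<open>a = exp h\<close> and \<open>b = exp_poly N h\<close> for \<open>h = x / m\<close>, the numerator is \<open>a^m - b^m\<close>, which lies
  between \<open>m * (a - b) * b^(m - 1)\<close> and \<open>m * (a - b) * a^(m - 1)\<close>.\<close>

lemma exp_poly_power_ratio_bounds:
  fixes x :: real and N m :: nat
  assumes "0 < x" "1 \<le> m"
  defines "q \<equiv> \<bar>exp x - exp_poly N (x / real m) ^ m\<bar> / (x ^ (N + 1) / (fact (N + 1) * real m ^ N) * exp x)"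
  shows "exp_poly N (x / real m) ^ (m - 1) * exp (- x) \<le> q"
    and "q \<le> (1 + x / real m * exp (x / real m) / real (N + 2)) * exp (- (x / real m))"
proof -
  define h where "h = x / real m"
  define a where "a = exp h"
  define b where "b = exp_poly N h"
  define t where "t = h ^ Suc N / fact (Suc N)"
  obtain n where m: "m = Suc n" using assms(2) by (cases m) auto
  have h: "0 < h" and x: "x = real m * h" using assms by (simp_all add: h_def)
  have ex: "exp x = a ^ m" unfolding x a_def by (rule exp_of_nat_mult)
  have b0: "0 \<le> b" and ba: "b \<le> a" and a0: "0 < a"
    using h by (auto simp: a_def b_def exp_poly_nonneg exp_poly_le_exp)
  have t: "0 < t" using h by (simp add: t_def del: fact_Suc)
  have R: "t \<le> a - b" "a - b \<le> t * (1 + h * exp h / real (N + 2))"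
    using exp_minus_exp_poly_bounds[of h N] h by (simp_all add: t_def a_def b_def del: fact_Suc power_Suc)
  have den: "x ^ (N + 1) / (fact (N + 1) * real m ^ N) * exp x = real m * t * exp x"
    using m by (simp add: x t_def power_mult_distrib field_simps del: fact_Suc of_nat_Suc)
  have "b ^ m \<le> a ^ m" using b0 ba by (rule power_mono[rotated])
  then have q: "q = (a ^ m - b ^ m) / (real m * t * exp x)"
    unfolding q_def den h_def[symmetric] b_def[symmetric] by (simp add: ex)
  have pos: "0 < real m * t * exp x" using t m by simp
  have "exp_poly N (x / real m) ^ (m - 1) * exp (- x) = real m * t * b ^ n / (real m * t * exp x)"
    using t by (simp add: m b_def h_def exp_minus field_simps del: of_nat_Suc)
  also have "\<dots> \<le> q"
    unfolding q
  proof (rule divide_right_mono)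
    have "real m * t * b ^ n \<le> real m * (a - b) * b ^ n"
      using R(1) b0 by (intro mult_right_mono mult_left_mono) auto
    also have "\<dots> \<le> a ^ m - b ^ m"
      using power_increment_lower[OF b0, of a n] a0 unfolding m by (simp add: mult_ac)
    finally show "real m * t * b ^ n \<le> a ^ m - b ^ m" .
  qed (use pos in simp)
  finally show "exp_poly N (x / real m) ^ (m - 1) * exp (- x) \<le> q" .
  let ?u = "1 + h * exp h / real (N + 2)"
  have "q \<le> real m * (t * ?u) * a ^ n / (real m * t * exp x)"
    unfolding q
  proof (rule divide_right_mono)
    have "a ^ m - b ^ m \<le> real m * (a - b) * a ^ n"
      using power_increment_lower[of a b n] a0 b0 unfolding m by (simp add: algebra_simps)
    also have "\<dots> \<le> real m * (t * ?u) * a ^ n"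
      using R(2) a0 by (intro mult_right_mono mult_left_mono) auto
    finally show "a ^ m - b ^ m \<le> real m * (t * ?u) * a ^ n" .
  qed (use pos in simp)
  also have "\<dots> = ?u * (a ^ n / exp x)" using t m by (simp del: of_nat_Suc)
  also have "a ^ n / exp x = exp (- h)"
    using a0 by (simp add: ex m exp_minus a_def field_simps)
  finally show "q \<le> (1 + x / real m * exp (x / real m) / real (N + 2)) * exp (- (x / real m))"
    unfolding h_def .
qed


section \<open>A straight path driving a scalar equation\<close>

text \<open>The powers of the arc length satisfy \<open>d(v^(n + 1) / (n + 1)!) = v^n / n! dv\<close> for
  \<open>v = r * (V u - V s)\<close>.\<close>

lemma (in bv_path) remainder_exp_term:
  assumes "0 \<le> r" "0 \<le> s" "s \<le> T"
  shows "remainder V s T (\<lambda>p x q. r * (V q - V p) * ((r * (V x - V s)) ^ n / fact n) -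
    ((r * (V q - V s)) ^ Suc n / fact (Suc n) - (r * (V p - V s)) ^ Suc n / fact (Suc n)))"
  unfolding remainder_def
proof (intro allI impI)
  fix \<epsilon> :: real assume \<epsilon>: "\<epsilon> > 0"
  define h where "h u = (r * (V u - V s)) ^ n / fact n" for u
  define H where "H u = (r * (V u - V s)) ^ Suc n / fact (Suc n)" for u
  have "{s..T} \<subseteq> {0..T}" using assms by auto
  then have "continuous_on {s..T} h"
    unfolding h_def by (intro continuous_intros continuous_on_subset[OF V_continuous]) auto
  then have "uniformly_continuous_on {s..T} h" by (simp add: compact_uniformly_continuous)
  moreover have \<epsilon>': "0 < \<epsilon> / (r + 1)" using \<epsilon> assms(1) by simp
  ultimately obtain \<delta> where \<delta>: "\<delta> > 0"
    "\<And>u v. \<lbrakk>u \<in> {s..T}; v \<in> {s..T}; \<bar>v - u\<bar> < \<delta>\<rbrakk> \<Longrightarrow> \<bar>h v - h u\<bar> < \<epsilon> / (r + 1)"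
    unfolding uniformly_continuous_on_def dist_real_def by metis
  have "\<bar>r * (V q - V p) * h x - (H q - H p)\<bar> \<le> \<epsilon> * (V q - V p)"
    if pxq: "s \<le> p \<and> p \<le> x \<and> x \<le> q \<and> q \<le> T \<and> q - p < \<delta>" for p x q
  proof -
    let ?a = "r * (V q - V p)"
    have mono: "V s \<le> V p" "V p \<le> V x" "V x \<le> V q" using V_mono pxq assms by auto
    have hm: "h p \<le> h x" "h x \<le> h q"
      unfolding h_def using mono assms(1)
      by (intro divide_right_mono power_mono mult_left_mono; simp)+
    have a: "0 \<le> ?a" using mono assms(1) by simp
    have "?a * h p \<le> H q - H p"
      using exp_term_increment[of r "V p - V s" "V q - V s" n] mono assms(1)
      unfolding h_def H_def by (simp add: mult_ac)
    moreover have "H q - H p \<le> ?a * h q"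
    proof -
      have "real (Suc n) * (r * (V q - V s)) ^ n * (r * (V p - V s) - r * (V q - V s)) / fact (Suc n) \<le>
          ((r * (V p - V s)) ^ Suc n - (r * (V q - V s)) ^ Suc n) / fact (Suc n)"
        using mono assms(1) by (intro divide_right_mono power_increment_lower) auto
      moreover have "real (Suc n) * (r * (V q - V s)) ^ n * (r * (V p - V s) - r * (V q - V s)) / fact (Suc n)
          = - (?a * h q)"
        by (simp add: h_def field_simps del: of_nat_Suc power_Suc)
      ultimately show ?thesis unfolding H_def by (simp only: diff_divide_distrib)
    qed
    moreover have "?a * h p \<le> ?a * h x" "?a * h x \<le> ?a * h q"
      using hm a by (simp_all add: mult_left_mono)
    ultimately have "\<bar>?a * h x - (H q - H p)\<bar> \<le> ?a * h q - ?a * h p" by (simp only: abs_le_iff) argo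
    also have "\<dots> = ?a * (h q - h p)" by (simp only: right_diff_distrib)
    also have "\<dots> \<le> ?a * (\<epsilon> / (r + 1))"
      using \<delta>(2)[of p q] pxq a by (intro mult_left_mono) auto
    also have "\<dots> = r * (\<epsilon> / (r + 1)) * (V q - V p)" by simp
    also have "\<dots> \<le> \<epsilon> * (V q - V p)"
      using \<epsilon> assms(1) mono by (intro mult_right_mono) (auto simp: field_simps)
    finally show ?thesis .
  qed
  then show "\<exists>\<delta>>0. \<forall>p x q. s \<le> p \<and> p \<le> x \<and> x \<le> q \<and> q \<le> T \<and> q - p < \<delta> \<longrightarrow>
    \<bar>r * (V q - V p) * ((r * (V x - V s)) ^ n / fact n) -
    ((r * (V q - V s)) ^ Suc n / fact (Suc n) - (r * (V p - V s)) ^ Suc n / fact (Suc n))\<bar> \<le> \<epsilon> * (V q - V p)"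
    using \<delta>(1) unfolding h_def H_def by blast
qed

text \<open>The path \<open>t \<mapsto> (L t / T, 0)\<close> in the plane.\<close>

definition line_path :: "real \<Rightarrow> real \<Rightarrow> real \<Rightarrow> rvec" where
  "line_path L T t = (\<lambda>i. if i = 0 then L * t / T else 0)"

text \<open>In dimension \<open>e = 1\<close>, where only \<open>j = k = 0\<close> matter, this field has the single nonzero coefficient
  \<open>r\<close>; the equation driven by the line is \<open>dY = r Y dX\<^sub>0\<close>.\<close>

definition scalar_field :: "real \<Rightarrow> lin_field" where
  "scalar_field r = (\<lambda>i j k. if i = 0 then r else 0)"

lemma vnorm_line_path:
  assumes "0 \<le> L" "0 < T" "a \<le> b"
  shows "vnorm 2 (\<lambda>i. line_path L T b i - line_path L T a i) = L * b / T - L * a / T"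
proof -
  have "{..<2} = {0, 1::nat}" by auto
  moreover have "L * a / T \<le> L * b / T" using assms by (intro divide_right_mono mult_left_mono) auto
  ultimately show ?thesis by (simp add: L2_set_def line_path_def)
qed

lemma line_path_C1var:
  assumes "0 \<le> L" "0 < T"
  shows "line_path L T \<in> C1var 2 T"
  unfolding C1var_def
proof (intro CollectI conjI allI impI)
  show "continuous_on {0..T} (\<lambda>t. line_path L T t i)" for i
    unfolding line_path_def using assms by (cases "i = 0") (auto intro!: continuous_intros)
  show "bdd_above (variation_sums 2 (line_path L T) 0 T)"
  proof (rule bdd_aboveI)
    fix x assume "x \<in> variation_sums 2 (line_path L T) 0 T"
    then obtain D where D: "D division_of {0..T}"
      and x: "x = (\<Sum>K\<in>D. vnorm 2 (\<lambda>i. line_path L T (Sup K) i - line_path L T (Inf K) i))"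
      by (auto simp: variation_sums_def)
    show "x \<le> L * T / T - L * 0 / T"
      unfolding x
      by (rule division_sum_le_diff[OF D, of "\<lambda>p q. vnorm 2 (\<lambda>i. line_path L T q i - line_path L T p i)"
            "\<lambda>u. L * u / T"])
         (use assms vnorm_line_path in auto)
  qed
qed

lemma frob_scalar_field:
  assumes "0 \<le> r"
  shows "frob 2 1 (scalar_field r) = r"
proof -
  have "{..<2} \<times> {..<1} \<times> {..<1} = {(0, 0, 0), (1, 0, 0) :: nat \<times> nat \<times> nat}" by auto
  then show ?thesis using assms by (simp add: frob_def L2_set_def scalar_field_def)
qed

text \<open>The scalar equation with rate \<open>r\<close> driven by the line of length \<open>L\<close>.\<close>

locale scalar_line =
  fixes T L r :: real
  assumes pos: "0 < T" "0 < L" "0 < r"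

sublocale scalar_line \<subseteq> linear_cde 2 "line_path L T" T 1 "scalar_field r" r
proof
  show "0 < T" by (rule pos)
  show "line_path L T \<in> C1var 2 T" using pos by (intro line_path_C1var) auto
  show "frob 2 1 (scalar_field r) \<le> r" using pos by (simp add: frob_scalar_field del: One_nat_def)
qed

context scalar_line begin

(* keeps the dimension 1 in the form in which it occurs in the locale parameters *)
declare One_nat_def [simp del]

lemma var1_line:
  assumes "0 \<le> a" "a \<le> b" "b \<le> T"
  shows "var1 2 (line_path L T) a b = L * b / T - L * a / T"
proof (rule antisym)
  show "var1 2 (line_path L T) a b \<le> L * b / T - L * a / T"
    by (rule var1_le_diff[OF assms(2)]) (use pos vnorm_line_path in auto)
  show "L * b / T - L * a / T \<le> var1 2 (line_path L T) a b"
    using vnorm_le_var1[OF assms] vnorm_line_path[of L T a b] pos assms by simp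
qed

lemma V_line: "0 \<le> u \<Longrightarrow> u \<le> T \<Longrightarrow> V u = L * u / T"
  using var1_line[of 0 u] by (simp add: V_def)

lemma level_line:
  assumes s: "0 \<le> s" "s \<le> u" "u \<le> T"
  shows "level n s y u 0 = (r * (V u - V s)) ^ n / fact n * y 0"
  using assms(2,3)
proof (induction n arbitrary: u)
  case 0
  then show ?case by (simp add: level_0)
next
  case (Suc n)
  have sT: "s \<le> T" using Suc.prems by simp
  let ?h = "\<lambda>u. (r * (V u - V s)) ^ n / fact n"
  let ?H = "\<lambda>u. (r * (V u - V s)) ^ Suc n / fact (Suc n)"
  let ?a = "\<lambda>p x q. lin_app 2 1 (scalar_field r) (\<lambda>i. line_path L T q i - line_path L T p i) (level n s y x) 0"
  let ?Z = "level (Suc n) s y"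
  have "remainder V s T (\<lambda>p x q. ?a p x q - (?Z q 0 - ?Z p 0))"
    using level_Suc(1)[OF s(1) sT, of n y] by (simp add: drives_def)
  moreover have "remainder V s T (\<lambda>p x q. y 0 * (r * (V q - V p) * ?h x - (?H q - ?H p)))"
    using pos by (intro remainder_cmult remainder_exp_term s sT) simp
  ultimately have "remainder V s T (\<lambda>p x q. y 0 * (r * (V q - V p) * ?h x - (?H q - ?H p)) -
      (?a p x q - (?Z q 0 - ?Z p 0)))" by (rule remainder_diff[rotated])
  then have "remainder V s T (\<lambda>p x q. (?Z q 0 - ?H q * y 0) - (?Z p 0 - ?H p * y 0))"
  proof (rule remainder_bound[of _ _ _ _ 1])
    fix p x q assume pxq: "s \<le> p" "p \<le> x" "x \<le> q" "q \<le> T"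
    have "{..<2} = {0, 1::nat}" "{..<1} = {0::nat}" by auto
    then have "?a p x q = (V q - V p) * (r * level n s y x 0)"
      using pxq s V_line[of p] V_line[of q] by (simp add: lin_app_def scalar_field_def line_path_def)
    also have "level n s y x 0 = ?h x * y 0" using Suc.IH[of x] pxq by simp
    finally have "(?Z q 0 - ?H q * y 0) - (?Z p 0 - ?H p * y 0) =
        y 0 * (r * (V q - V p) * ?h x - (?H q - ?H p)) - (?a p x q - (?Z q 0 - ?Z p 0))"
      by (simp add: algebra_simps del: power_Suc fact_Suc)
    then show "\<bar>(?Z q 0 - ?H q * y 0) - (?Z p 0 - ?H p * y 0)\<bar> \<le>
        1 * \<bar>y 0 * (r * (V q - V p) * ?h x - (?H q - ?H p)) - (?a p x q - (?Z q 0 - ?Z p 0))\<bar>" by simp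
  qed simp
  then have "remainder V s u (\<lambda>p x q. (?Z q 0 - ?H q * y 0) - (?Z p 0 - ?H p * y 0))"
    using Suc.prems by (intro remainder_subinterval[of V s T _ s u]) simp_all
  then have "?Z u 0 - ?H u * y 0 = ?Z s 0 - ?H s * y 0"
    using Suc.prems(1) by (rule remainder_increment_zero)
  then show ?case by (simp add: level_Suc(2)[OF s(1) sT] del: fact_Suc)
qed

lemma euler_step_line:
  assumes "0 \<le> s" "s \<le> u" "u \<le> T"
  shows "euler_step 2 1 (scalar_field r) N (line_path L T) s u y 0 = exp_poly N (r * (V u - V s)) * y 0"
  unfolding euler_step_eq exp_poly_def by (simp add: level_line[OF assms] sum_distrib_right)

lemma flow_line: "flow 2 1 (scalar_field r) (line_path L T) 0 T y 0 = exp (r * L) * y 0"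
proof -
  have VT: "V T = L" using V_line[of T] pos by simp
  have "(\<lambda>N. exp_poly N (r * L) * y 0) \<longlonglongrightarrow> series 0 y T 0"
    using euler_step_tendsto[of 0 T 0 y] euler_step_line[of 0 T _ y] T by (simp add: VT V_0)
  moreover have "(\<lambda>N. exp_poly N (r * L) * y 0) \<longlonglongrightarrow> exp (r * L) * y 0"
    by (intro tendsto_intros exp_poly_tendsto)
  ultimately have "series 0 y T 0 = exp (r * L) * y 0" by (rule LIMSEQ_unique)
  then show ?thesis using flow_eq_series[of 0 T 0 y] T by simp
qed

lemma euler_error_line:
  assumes P: "equal_length_split 2 (line_path L T) T m \<pi>" and "1 \<le> m"
  shows "euler_error 2 1 (scalar_field r) (line_path L T) T (\<lambda>_. 1) N m \<pi> =
    \<bar>exp (r * L) - exp_poly N (r * L / real m) ^ m\<bar>"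
proof -
  have part: "is_partition T m \<pi>" using P by (simp add: equal_length_split_def)
  have "euler_scheme 2 1 (scalar_field r) N (line_path L T) \<pi> k (\<lambda>_. 1) 0 =
      exp_poly N (r * L / real m) ^ k" if "k \<le> m" for k
    using that
  proof (induction k)
    case (Suc k)
    have st: "0 \<le> \<pi> k" "\<pi> k \<le> \<pi> (Suc k)" "\<pi> (Suc k) \<le> T"
      using partition_bounds[OF part] partition_mono[OF part] Suc.prems by auto
    have "V (\<pi> (Suc k)) - V (\<pi> k) = var1 2 (line_path L T) 0 T / real m"
      using P Suc.prems var1_eq_V_diff[OF st] by (simp add: equal_length_split_def)
    also have "var1 2 (line_path L T) 0 T = L" using var1_line[of 0 T] pos by simp
    finally show ?case using Suc euler_step_line[OF st] by (simp add: mult.commute)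
  qed simp
  then show ?thesis
    by (simp add: euler_error_def L2_set_def flow_line)
qed

lemma euler_error_ratio_bounds:
  fixes N m :: nat
  assumes P: "equal_length_split 2 (line_path L T) T m \<pi>" and m: "1 \<le> m"
  defines "q \<equiv> euler_error 2 1 (scalar_field r) (line_path L T) T (\<lambda>_. 1) N m \<pi> /
      split_bound r L 1 (\<lambda>_. 1) N m"
  shows "exp_poly N (r * L / real m) ^ (m - 1) * exp (- (r * L)) \<le> q"
    and "q \<le> (1 + r * L / real m * exp (r * L / real m) / real (N + 2)) * exp (- (r * L / real m))"
proof -
  have x: "0 < r * L" using pos by simp
  have "vnorm 1 (\<lambda>_. 1) = 1" by (simp add: L2_set_def)
  then have q: "q = \<bar>exp (r * L) - exp_poly N (r * L / real m) ^ m\<bar> /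
      ((r * L) ^ (N + 1) / (fact (N + 1) * real m ^ N) * exp (r * L))"
    unfolding q_def split_bound_def euler_error_line[OF P m] by (simp only: mult_1_right)
  show "exp_poly N (r * L / real m) ^ (m - 1) * exp (- (r * L)) \<le> q"
    and "q \<le> (1 + r * L / real m * exp (r * L / real m) / real (N + 2)) * exp (- (r * L / real m))"
    unfolding q by (rule exp_poly_power_ratio_bounds[OF x m])+
qed

lemma euler_error_ratio_steps:
  assumes P: "\<And>m. 1 \<le> m \<Longrightarrow> equal_length_split 2 (line_path L T) T m (P m)" and N: "1 \<le> N"
  shows "(\<lambda>m. euler_error 2 1 (scalar_field r) (line_path L T) T (\<lambda>_. 1) N m (P m) /
      split_bound r L 1 (\<lambda>_. 1) N m) \<longlonglongrightarrow> 1"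
proof -
  let ?x = "r * L"
  let ?q = "\<lambda>m. euler_error 2 1 (scalar_field r) (line_path L T) T (\<lambda>_. 1) N m (P m) /
      split_bound r L 1 (\<lambda>_. 1) N m"
  have x: "0 < ?x" using pos by simp
  have h: "(\<lambda>m. ?x / real m) \<longlonglongrightarrow> 0" by (rule lim_const_over_n)
  let ?u = "\<lambda>m. (1 + ?x / real m * exp (?x / real m) / real (N + 2)) * exp (- (?x / real m))"
  \<comment> \<open>for \<open>m \<ge> 1\<close> the quotient is \<open>(1 + x / m)^(m - 1)\<close>, and \<open>1 + h\<close> is at most the Taylor polynomial as \<open>N \<ge> 1\<close>\<close>
  let ?l = "\<lambda>m. (1 + ?x / real m) ^ m / (1 + ?x / real m) * exp (- ?x)"
  have "?u \<longlonglongrightarrow> (1 + 0 * exp 0 / real (N + 2)) * exp (- 0)"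
    by (intro tendsto_intros h) simp
  then have u: "?u \<longlonglongrightarrow> 1" by simp
  have "?l \<longlonglongrightarrow> exp ?x / (1 + 0) * exp (- ?x)"
    by (intro tendsto_intros tendsto_exp_limit_sequentially h) simp
  then have l: "?l \<longlonglongrightarrow> 1" by (simp add: exp_minus)
  have q_le: "\<forall>\<^sub>F m in sequentially. ?q m \<le> ?u m"
    using eventually_ge_at_top[of 1] by eventually_elim (rule euler_error_ratio_bounds(2)[OF P])
  have le_q: "\<forall>\<^sub>F m in sequentially. ?l m \<le> ?q m"
    using eventually_ge_at_top[of 1]
  proof eventually_elim
    case (elim m)
    have h0: "0 < ?x / real m" using x elim by simp
    have "?l m = (1 + ?x / real m) ^ (m - 1) * exp (- ?x)"
      using elim h0 by (cases m) auto
    also have "\<dots> \<le> exp_poly N (?x / real m) ^ (m - 1) * exp (- ?x)"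
      using exp_poly_ge[of "?x / real m" N] N h0 by (intro mult_right_mono power_mono) auto
    also have "\<dots> \<le> ?q m" by (rule euler_error_ratio_bounds(1)[OF P[OF elim] elim])
    finally show ?case .
  qed
  show ?thesis by (rule tendsto_sandwich[OF le_q q_le l u])
qed

lemma euler_error_ratio_degree:
  assumes P: "equal_length_split 2 (line_path L T) T m \<pi>" and m: "1 \<le> m"
  shows "(\<lambda>N. euler_error 2 1 (scalar_field r) (line_path L T) T (\<lambda>_. 1) N m \<pi> /
      split_bound r L 1 (\<lambda>_. 1) N m) \<longlonglongrightarrow> exp (- (r * L / real m))"
proof -
  let ?h = "r * L / real m"
  have "(\<lambda>N. exp_poly N ?h ^ (m - 1) * exp (- (r * L))) \<longlonglongrightarrow> exp ?h ^ (m - 1) * exp (- (r * L))"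
    by (intro tendsto_intros exp_poly_tendsto)
  also have "exp ?h ^ (m - 1) * exp (- (r * L)) = exp (- ?h)"
  proof -
    have "real (m - 1) * ?h + - (r * L) = - ?h"
      using m by (simp add: of_nat_diff field_simps)
    then show ?thesis by (simp only: exp_of_nat_mult[symmetric] exp_add[symmetric])
  qed
  finally have l: "(\<lambda>N. exp_poly N ?h ^ (m - 1) * exp (- (r * L))) \<longlonglongrightarrow> exp (- ?h)" .
  have "(\<lambda>N. 1 / real (N + 2)) \<longlonglongrightarrow> 0"
    using LIMSEQ_ignore_initial_segment[OF lim_const_over_n[of 1], of 2] by simp
  then have "(\<lambda>N. (1 + ?h * exp ?h * (1 / real (N + 2))) * exp (- ?h)) \<longlonglongrightarrow>
      (1 + ?h * exp ?h * 0) * exp (- ?h)"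
    by (intro tendsto_intros)
  then have u: "(\<lambda>N. (1 + ?h * exp ?h / real (N + 2)) * exp (- ?h)) \<longlonglongrightarrow> exp (- ?h)" by simp
  show ?thesis
    by (rule tendsto_sandwich[OF _ _ l u])
       (intro always_eventually allI euler_error_ratio_bounds[OF P m])+
qed

end

theorem theorem1p3:
  fixes T :: real
  assumes "T > 0"
  shows
    "(\<forall>d e r X A y0 N m \<pi>.
        2 \<le> d \<and> 1 \<le> e \<and> 0 < r \<and> X \<in> C1var d T \<and> frob d e A \<le> r \<and>
        1 \<le> N \<and> 1 \<le> m \<and> is_partition T m \<pi> \<longrightarrow>
          euler_error d e A X T y0 N m \<pi> \<le> partition_bound r d e X T y0 N m \<pi> \<and>
          (equal_length_split d X T m \<pi> \<longrightarrow>
             partition_bound r d e X T y0 N m \<pi> = split_bound r (var1 d X 0 T) e y0 N m \<and>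
             (\<forall>\<sigma>. is_partition T m \<sigma> \<longrightarrow>
                partition_bound r d e X T y0 N m \<pi> \<le> partition_bound r d e X T y0 N m \<sigma>)) \<and>
          (\<exists>\<sigma>. equal_length_split d X T m \<sigma>))
     \<and>
     (\<forall>r L. 0 < r \<and> 0 < L \<longrightarrow>
        (\<exists>d e X A y0 c.
           2 \<le> d \<and> 1 \<le> e \<and> X \<in> C1var d T \<and> var1 d X 0 T = L \<and> frob d e A = r \<and>
           (\<exists>j<e. y0 j \<noteq> 0) \<and>
           (\<forall>m\<ge>1. \<exists>\<sigma>. equal_length_split d X T m \<sigma>) \<and>
           (\<forall>m\<ge>1. c m > 0) \<and> c \<longlonglongrightarrow> (1::real) \<and>
           (\<forall>P. (\<forall>m\<ge>1. equal_length_split d X T m (P m)) \<longrightarrow>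
              (\<forall>N\<ge>1. (\<lambda>m. euler_error d e A X T y0 N m (P m) / split_bound r L e y0 N m)
                        \<longlonglongrightarrow> 1) \<and>
              (\<forall>m\<ge>1. (\<lambda>N. euler_error d e A X T y0 N m (P m) / split_bound r L e y0 N m)
                        \<longlonglongrightarrow> c m))))"
proof (rule conjI; intro allI impI)
  fix d e N m :: nat and r :: real and X A y0 \<pi>
  assume asm: "2 \<le> d \<and> 1 \<le> e \<and> 0 < r \<and> X \<in> C1var d T \<and> frob d e A \<le> r \<and>
        1 \<le> N \<and> 1 \<le> m \<and> is_partition T m \<pi>"
  interpret linear_cde d X T e A r by unfold_locales (use assms asm in auto)
  have m: "0 < m" and part: "is_partition T m \<pi>" using asm by auto
  show "euler_error d e A X T y0 N m \<pi> \<le> partition_bound r d e X T y0 N m \<pi> \<and>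
          (equal_length_split d X T m \<pi> \<longrightarrow>
             partition_bound r d e X T y0 N m \<pi> = split_bound r (var1 d X 0 T) e y0 N m \<and>
             (\<forall>\<sigma>. is_partition T m \<sigma> \<longrightarrow>
                partition_bound r d e X T y0 N m \<pi> \<le> partition_bound r d e X T y0 N m \<sigma>)) \<and>
          (\<exists>\<sigma>. equal_length_split d X T m \<sigma>)"
    using euler_error_le[OF part] partition_bound_equal_split[OF m]
      split_bound_le_partition_bound[OF m r_nonneg] equal_length_split_exists[OF m] by simp
next
  fix r L :: real assume "0 < r \<and> 0 < L"
  then interpret scalar_line T L r by unfold_locales (use assms in auto)
  let ?c = "\<lambda>m. exp (- (r * L / real m))"
  have "?c \<longlonglongrightarrow> exp (- 0)" by (intro tendsto_intros lim_const_over_n)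
  then have c: "?c \<longlonglongrightarrow> 1" by simp
  show "\<exists>d e X A y0 c.
           2 \<le> d \<and> 1 \<le> e \<and> X \<in> C1var d T \<and> var1 d X 0 T = L \<and> frob d e A = r \<and>
           (\<exists>j<e. y0 j \<noteq> 0) \<and>
           (\<forall>m\<ge>1. \<exists>\<sigma>. equal_length_split d X T m \<sigma>) \<and>
           (\<forall>m\<ge>1. c m > 0) \<and> c \<longlonglongrightarrow> (1::real) \<and>
           (\<forall>P. (\<forall>m\<ge>1. equal_length_split d X T m (P m)) \<longrightarrow>
              (\<forall>N\<ge>1. (\<lambda>m. euler_error d e A X T y0 N m (P m) / split_bound r L e y0 N m)
                        \<longlonglongrightarrow> 1) \<and>
              (\<forall>m\<ge>1. (\<lambda>N. euler_error d e A X T y0 N m (P m) / split_bound r L e y0 N m)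
                        \<longlonglongrightarrow> c m))"
  proof (rule exI[of _ 2], rule exI[of _ 1], rule exI[of _ "line_path L T"],
      rule exI[of _ "scalar_field r"], rule exI[of _ "\<lambda>_. 1"], rule exI[of _ ?c],
      intro conjI allI impI)
    show "line_path L T \<in> C1var 2 T" by (rule X)
    show "var1 2 (line_path L T) 0 T = L" using var1_line[of 0 T] pos by simp
    show "frob 2 1 (scalar_field r) = r" using pos by (intro frob_scalar_field) simp
    show "\<exists>\<sigma>. equal_length_split 2 (line_path L T) T m \<sigma>" if "1 \<le> m" for m
      by (rule equal_length_split_exists) (use that in simp)
    show "?c \<longlonglongrightarrow> 1" by (rule c)
    fix P assume P: "\<forall>m\<ge>1. equal_length_split 2 (line_path L T) T m (P m)"
    show "(\<lambda>m. euler_error 2 1 (scalar_field r) (line_path L T) T (\<lambda>_. 1) N m (P m) /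
        split_bound r L 1 (\<lambda>_. 1) N m) \<longlonglongrightarrow> 1" if "1 \<le> N" for N
      using P that by (intro euler_error_ratio_steps) blast
    show "(\<lambda>N. euler_error 2 1 (scalar_field r) (line_path L T) T (\<lambda>_. 1) N m (P m) /
        split_bound r L 1 (\<lambda>_. 1) N m) \<longlonglongrightarrow> ?c m" if "1 \<le> m" for m
      using P that by (intro euler_error_ratio_degree) blast
  qed simp_all
qed

end
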